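(* (i) $E_2(x)=\tfrac12x(x^3+3x^2-4x-1)+\tfrac14(2x^4-4x^3+29x^2-15x+2)(1-4x)^{-3/2}-\tfrac14(16x^7-48x^6-76x^5+64x^4+36x^3-21x^2-5x+2)(1-4x^2)^{-3/2}$. (ii) $O_2(x)=-\tfrac12(x^4+3x^3-5x^2-4x+2)+\tfrac14(2x^4-4x^3+29x^2-15x+2)(1-4x)^{-3/2}+\tfrac14(16x^7-48x^6-76x^5+64x^4+36x^3-21x^2-5x+2)(1-4x^2)^{-3/2}$. (iii) $F_2(x)=\tfrac12(x^2+3x-2)+\tfrac12(2x^4-4x^3+29x^2-15x+2)(1-4x)^{-3/2}$.
   Context: An occurrence of $132$ in $\pi=\pi_1\cdots\pi_n\in\mathfrak S_n$ is a triple $i<j<k$ with $\pi_i<\pi_k<\pi_j$. A permutation is even or odd according to the parity of its number of inversions. $E_2(x)$ is $\sum_{n\ge0}$ (number of even $\pi\in\mathfrak S_n$ with exactly two occurrences of $132$) $x^n$. $O_2(x)$ is the same with odd permutations. $F_2(x)=E_2(x)+O_2(x)$. *)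

theory Defs
  imports
    "HOL-Combinatorics.Permutations"
    "HOL-Computational_Algebra.Formal_Power_Series"
begin

definition inversions :: "nat \<Rightarrow> (nat \<Rightarrow> nat) \<Rightarrow> (nat \<times> nat) set" where
  "inversions n p = {(i, j). i \<in> {1..n} \<and> j \<in> {1..n} \<and> i < j \<and> p j < p i}"

definition occurrences_132 :: "nat \<Rightarrow> (nat \<Rightarrow> nat) \<Rightarrow> (nat \<times> nat \<times> nat) set" where
  "occurrences_132 n p =
     {(i, j, k). i \<in> {1..n} \<and> j \<in> {1..n} \<and> k \<in> {1..n} \<and> i < j \<and> j < k \<and> p i < p k \<and> p k < p j}"

definition even_perms_132 :: "nat \<Rightarrow> nat \<Rightarrow> (nat \<Rightarrow> nat) set" where
  "even_perms_132 r n =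
     {p. p permutes {1..n} \<and> card (occurrences_132 n p) = r \<and> even (card (inversions n p))}"

definition odd_perms_132 :: "nat \<Rightarrow> nat \<Rightarrow> (nat \<Rightarrow> nat) set" where
  "odd_perms_132 r n =
     {p. p permutes {1..n} \<and> card (occurrences_132 n p) = r \<and> odd (card (inversions n p))}"

definition E2 :: "rat fps" where
  "E2 = Abs_fps (\<lambda>n. of_nat (card (even_perms_132 2 n)))"

definition O2 :: "rat fps" where
  "O2 = Abs_fps (\<lambda>n. of_nat (card (odd_perms_132 2 n)))"

definition F2 :: "rat fps" where
  "F2 = E2 + O2"

text \<open>Only meaningful if \<open>g\<close> has constant term \<open>1\<close>: then \<open>g\<close> to the exponent \<open>a\<close> is the
  binomial series \<open>\<Sum>k. (a gchoose k) * (g - 1) ^ k\<close>, which converges coefficientwise.\<close>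

definition fps_powr :: "'a::field_char_0 fps \<Rightarrow> 'a \<Rightarrow> 'a fps" where
  "fps_powr g a = fps_binomial a oo (g - 1)"

abbreviation X :: "rat fps" where
  "X \<equiv> fps_X"

end

theory Submission
  imports
    Defs
    "HOL-Combinatorics.Multiset_Permutations"
    "HOL-Library.Infinite_Set"
begin

text \<open>Write a permutation of \<open>{..<n + 1}\<close> as \<open>ys @ n # zs\<close>. Every pair \<open>x < z\<close> with \<open>x\<close> in \<open>ys\<close>
  and \<open>z\<close> in \<open>zs\<close> gives an occurrence \<open>x n z\<close> of 132, so at most two occurrences allow at most two such
  pairs. This leaves four shapes for the value set of \<open>ys\<close>, according to the number of pairs
  (none, one, or two in two ways), and in each shape the further occurrences are governed by the
  position of one or two extreme values. Weighting a permutation by \<open>e ^ inversions\<close> with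
  \<open>e = 1\<close> or \<open>e = -1\<close> yields recurrences for the series of permutations with 0, 1 and 2 occurrences in
  which the convolution carries the sign \<open>e ^ (j * (1 + i))\<close>. For \<open>e = 1\<close> this is the ordinary product;
  for \<open>e = -1\<close> it is a polynomial in the two series and their images under \<open>x \<mapsto> -x\<close>. In both cases the
  occurrence-free series is a Catalan series \<open>b\<close> up to constants, and the remaining equations are linear with leading
  factor \<open>s = 1 - 2 * x * b\<close>, where \<open>s\<^sup>2\<close> is \<open>1 - 4 * x\<close> or \<open>1 - 4 * x\<^sup>2\<close>.\<close>

unbundle fps_syntax

subsection \<open>Inversions and occurrences of 132 in lists\<close>

fun inv_count :: "'a::linorder list \<Rightarrow> nat" where
  "inv_count [] = 0"
| "inv_count (x # xs) = length (filter (\<lambda>y. y < x) xs) + inv_count xs"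

text \<open>Occurrences are grouped by their first entry: those starting at \<open>x\<close> are the
  inversions among the later entries that exceed \<open>x\<close>.\<close>

fun occ_count :: "'a::linorder list \<Rightarrow> nat" where
  "occ_count [] = 0"
| "occ_count (x # xs) = inv_count (filter (\<lambda>y. x < y) xs) + occ_count xs"

text \<open>The number of occurrences of 132 in \<open>xs @ [z]\<close> whose middle value is \<open>z\<close>.\<close>

fun straddle_count :: "'a::linorder \<Rightarrow> 'a list \<Rightarrow> nat" where
  "straddle_count z [] = 0"
| "straddle_count z (x # xs) =
     (if x < z then length (filter (\<lambda>y. z < y) xs) else 0) + straddle_count z xs"

lemma inv_count_append:
  "inv_count (xs @ ys) = inv_count xs + inv_count ys + (\<Sum>x\<leftarrow>xs. length (filter (\<lambda>y. y < x) ys))"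
  by (induction xs) auto

lemma sum_list_length_filter_swap:
  "(\<Sum>x\<leftarrow>xs. length (filter (P x) ys)) = (\<Sum>y\<leftarrow>ys. length (filter (\<lambda>x. P x y) xs))"
proof (induction xs)
  case (Cons x xs)
  have "length (filter (P x) ys) + (\<Sum>y\<leftarrow>ys. length (filter (\<lambda>x. P x y) xs))
      = (\<Sum>y\<leftarrow>ys. length (filter (\<lambda>x. P x y) (x # xs)))"
    by (induction ys) auto
  with Cons show ?case by simp
qed simp

lemma sum_list_filter_if:
  "(\<Sum>y\<leftarrow>filter P ys. f y) = (\<Sum>y\<leftarrow>ys. if P y then f y else (0::nat))"
  by (induction ys) auto

text \<open>An occurrence lies in one of the lists, or has its first entry in \<open>xs\<close> and
  an inversion in \<open>ys\<close>, or has two entries in \<open>xs\<close> and its last one, which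
  is the middle value, in \<open>ys\<close>.\<close>

lemma occ_count_append:
  "occ_count (xs @ ys) = occ_count xs + occ_count ys
     + (\<Sum>x\<leftarrow>xs. inv_count (filter (\<lambda>y. x < y) ys)) + (\<Sum>z\<leftarrow>ys. straddle_count z xs)"
proof (induction xs)
  case (Cons x xs)
  \<comment> \<open>Entries above \<open>z\<close> are automatically above \<open>x\<close>. This
    matches the occurrences with first entry \<open>x\<close> and last entry \<open>z\<close> in
    \<open>ys\<close> with the summand of \<open>straddle_count\<close> for
    \<open>x\<close>.\<close>
  have *: "filter (\<lambda>y. z < y) (filter (\<lambda>y. x < y) xs) = filter (\<lambda>y. z < y) xs" if "x < z" for z
    unfolding filter_filter using that by (intro filter_cong) auto
  have "(\<Sum>u\<leftarrow>filter (\<lambda>y. x < y) xs. length (filter (\<lambda>y. y < u) (filter (\<lambda>y. x < y) ys)))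
      = (\<Sum>z\<leftarrow>ys. if x < z then length (filter (\<lambda>y. z < y) xs) else 0)"
    by (subst sum_list_length_filter_swap, unfold sum_list_filter_if)
      (intro arg_cong[of _ _ sum_list] map_cong refl if_cong, simp only: *)
  with Cons show ?case
    by (simp add: inv_count_append sum_list_addf)
qed simp

lemma inv_count_eq_0_iff: "inv_count xs = 0 \<longleftrightarrow> sorted xs"
  by (induction xs) (auto simp: filter_empty_conv not_less)

lemma inv_count_map:
  "strict_mono_on (set xs) f \<Longrightarrow> inv_count (map f xs) = inv_count xs"
proof (induction xs)
  case (Cons x xs)
  have "filter (\<lambda>y. f y < f x) xs = filter (\<lambda>y. y < x) xs"
    using Cons.prems by (intro filter_cong) (auto simp: strict_mono_on_less)
  moreover have "strict_mono_on (set xs) f"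
    using Cons.prems by (auto simp: strict_mono_on_def)
  ultimately show ?case
    using Cons.IH by (simp add: filter_map o_def)
qed simp

lemma occ_count_map:
  "strict_mono_on (set xs) f \<Longrightarrow> occ_count (map f xs) = occ_count xs"
proof (induction xs)
  case (Cons x xs)
  have "filter (\<lambda>y. f x < f y) xs = filter (\<lambda>y. x < y) xs"
    using Cons.prems by (intro filter_cong) (auto simp: strict_mono_on_less)
  moreover have "strict_mono_on (set xs) f" "strict_mono_on (set (filter (\<lambda>y. x < y) xs)) f"
    using Cons.prems by (auto simp: strict_mono_on_def)
  ultimately show ?case
    using Cons.IH by (simp add: filter_map o_def inv_count_map)
qed simp

section \<open>From functions on positions to lists of values\<close>

lemma inv_count_map_sorted:
  fixes f :: "'a::linorder \<Rightarrow> 'b::linorder"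
  assumes "sorted_wrt (<) is"
  shows "inv_count (map f is) = card {(i, j). i \<in> set is \<and> j \<in> set is \<and> i < j \<and> f j < f i}"
  using assms
proof (induction "is")
  case (Cons i js)
  let ?A = "{j \<in> set js. f j < f i}"
  let ?B = "{(i, j). i \<in> set js \<and> j \<in> set js \<and> i < j \<and> f j < f i}"
  have "{(k, j). k \<in> set (i # js) \<and> j \<in> set (i # js) \<and> k < j \<and> f j < f k} = Pair i ` ?A \<union> ?B"
    using Cons.prems by (auto dest: less_asym)
  moreover have "Pair i ` ?A \<inter> ?B = {}"
    using Cons.prems by auto
  moreover have "finite ?B"
    by (rule finite_subset[of _ "set js \<times> set js"]) auto
  moreover have "distinct js"
    using Cons.prems strict_sorted_iff by auto
  then have "length (filter (\<lambda>y. f y < f i) js) = card ?A"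
    by (metis distinct_card distinct_filter set_filter)
  moreover have "card (Pair i ` ?A) = card ?A"
    by (simp add: card_image inj_on_def)
  ultimately show ?case
    using Cons by (simp add: card_Un_disjoint filter_map o_def)
qed simp

lemma occ_count_map_sorted:
  fixes f :: "'a::linorder \<Rightarrow> 'b::linorder"
  assumes "sorted_wrt (<) is"
  shows "occ_count (map f is) = card {(i, j, k). i \<in> set is \<and> j \<in> set is \<and> k \<in> set is \<and>
           i < j \<and> j < k \<and> f i < f k \<and> f k < f j}"
  using assms
proof (induction "is")
  case (Cons i js)
  let ?A = "{(j, k). j \<in> set (filter (\<lambda>y. f i < f y) js) \<and> k \<in> set (filter (\<lambda>y. f i < f y) js)
    \<and> j < k \<and> f k < f j}"
  let ?B = "{(i, j, k). i \<in> set js \<and> j \<in> set js \<and> k \<in> set js \<and>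
           i < j \<and> j < k \<and> f i < f k \<and> f k < f j}"
  have "{(l, j, k). l \<in> set (i # js) \<and> j \<in> set (i # js) \<and> k \<in> set (i # js) \<and>
           l < j \<and> j < k \<and> f l < f k \<and> f k < f j} = Pair i ` ?A \<union> ?B"
    using Cons.prems by (auto dest: less_asym less_trans)
  moreover have "Pair i ` ?A \<inter> ?B = {}"
    using Cons.prems by auto
  moreover have "finite ?B"
    by (rule finite_subset[of _ "set js \<times> set js \<times> set js"]) auto
  moreover have "finite ?A"
    by (rule finite_subset[of _ "set js \<times> set js"]) auto
  moreover have "inv_count (filter (\<lambda>y. f i < y) (map f js)) = card ?A"
    using Cons.prems inv_count_map_sorted[of "filter (\<lambda>y. f i < f y) js" f]
    by (simp add: filter_map o_def sorted_wrt_filter)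
  moreover have "card (Pair i ` ?A) = card ?A"
    by (rule card_image) (simp add: inj_on_def)
  ultimately show ?case
    using Cons by (simp add: card_Un_disjoint)
next
  case Nil
  have "{(i :: 'a, j :: 'a, k :: 'a). False} = {}"
    by blast
  then show ?case
    by simp
qed

lemma bij_betw_permutes_lists:
  "bij_betw (\<lambda>p. map p [1..<Suc n]) {p. p permutes {1..n}} (permutations_of_set {1..n})"
proof -
  let ?h = "\<lambda>p. map p [1..<Suc n]" and ?P = "{p. p permutes {1..n}}"
  have inj: "inj_on ?h ?P"
  proof (rule inj_onI)
    fix p q assume pq: "p \<in> ?P" "q \<in> ?P" and "?h p = ?h q"
    then have "p i = q i" if "i \<in> {1..n}" for i
      using that by (auto simp: map_eq_conv simp del: upt_Suc)
    moreover have "p i = q i" if "i \<notin> {1..n}" for i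
      using that pq by (simp add: permutes_not_in)
    ultimately show "p = q"
      by blast
  qed
  have "?h ` ?P \<subseteq> permutations_of_set {1..n}"
    by (auto simp: permutations_of_set_def atLeastLessThanSuc_atLeastAtMost permutes_image
        distinct_map permutes_inj_on simp del: upt_Suc)
  \<comment> \<open>Surjectivity by counting: both sets have factorial \<open>n\<close>
    elements.\<close>
  moreover have "card (?h ` ?P) = card (permutations_of_set {1..n})"
    by (subst card_image[OF inj], subst card_permutations) auto
  ultimately have "?h ` ?P = permutations_of_set {1..n}"
    by (simp add: card_subset_eq)
  with inj show ?thesis
    by (simp add: bij_betw_def)
qed

lemma card_inversions: "card (inversions n p) = inv_count (map p [1..<Suc n])"
  by (subst inv_count_map_sorted)
    (simp_all only: inversions_def set_upt atLeastLessThanSuc_atLeastAtMost sorted_wrt_upt)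

lemma card_occurrences_132: "card (occurrences_132 n p) = occ_count (map p [1..<Suc n])"
  by (subst occ_count_map_sorted)
    (simp_all only: occurrences_132_def set_upt atLeastLessThanSuc_atLeastAtMost sorted_wrt_upt)

subsection \<open>Splitting a permutation at its maximum or minimum\<close>

text \<open>A permutation is determined by the value set \<open>A\<close> of the part before
  \<open>m\<close> and the orders of both parts. With \<open>m\<close> the maximum this drives the
  recurrences.\<close>

lemma sum_permutations_split:
  assumes "finite S" "m \<notin> S"
  shows "(\<Sum>xs\<in>permutations_of_set (insert m S). h xs) =
    (\<Sum>A\<in>Pow S. \<Sum>ys\<in>permutations_of_set A. \<Sum>zs\<in>permutations_of_set (S - A). h (ys @ m # zs))"
proof -
  let ?T = "SIGMA A:Pow S. permutations_of_set A \<times> permutations_of_set (S - A)"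
  let ?ys = "takeWhile (\<lambda>x. x \<noteq> m)" and ?zs = "\<lambda>xs. tl (dropWhile (\<lambda>x. x \<noteq> m) xs)"
  have "(\<Sum>xs\<in>permutations_of_set (insert m S). h xs) = (\<Sum>(A, ys, zs)\<in>?T. h (ys @ m # zs))"
  proof (rule sum.reindex_bij_witness[where j = "\<lambda>xs. (set (?ys xs), ?ys xs, ?zs xs)"
        and i = "\<lambda>(A, ys, zs). ys @ m # zs"])
    fix xs assume xs: "xs \<in> permutations_of_set (insert m S)"
    then obtain ys zs where s: "xs = ys @ m # zs" "m \<notin> set ys"
      by (metis insertI1 permutations_of_setD(1) split_list_first)
    then have tw: "?ys xs = ys" "?zs xs = zs"
      by (auto simp: takeWhile_append dropWhile_append)
    have "S = set ys \<union> set zs" "distinct (ys @ m # zs)"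
      using xs s assms by (auto simp: permutations_of_set_def)
    then show "(set (?ys xs), ?ys xs, ?zs xs) \<in> ?T"
      unfolding tw by (auto simp: permutations_of_set_def)
    show "(case (set (?ys xs), ?ys xs, ?zs xs) of (A, ys, zs) \<Rightarrow> ys @ m # zs) = xs"
      unfolding tw using s by simp
    show "(case (set (?ys xs), ?ys xs, ?zs xs) of (A, ys, zs) \<Rightarrow> h (ys @ m # zs)) = h xs"
      unfolding tw using s by simp
  next
    fix p assume "p \<in> ?T"
    then obtain A ys zs where p: "p = (A, ys, zs)" "A \<subseteq> S" "set ys = A" "distinct ys"
        "set zs = S - A" "distinct zs"
      by (auto simp: permutations_of_set_def)
    have "m \<notin> set ys"
      using p assms by auto
    then have tw: "?ys (ys @ m # zs) = ys" "?zs (ys @ m # zs) = zs"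
      by (auto simp: takeWhile_append dropWhile_append)
    show "(case p of (A, ys, zs) \<Rightarrow> ys @ m # zs) \<in> permutations_of_set (insert m S)"
      using p assms by (auto simp: permutations_of_set_def)
    show "(\<lambda>xs. (set (?ys xs), ?ys xs, ?zs xs)) (case p of (A, ys, zs) \<Rightarrow> ys @ m # zs) = p"
      using p tw by simp
  qed
  also have "\<dots> = (\<Sum>A\<in>Pow S. \<Sum>(ys, zs)\<in>permutations_of_set A \<times> permutations_of_set (S - A). h (ys @ m # zs))"
    using assms by (subst sum.Sigma) auto
  finally show ?thesis
    by (simp add: sum.cartesian_product)
qed

text \<open>The complementary view: delete \<open>m\<close> and remember its position
  \<open>k\<close>. It serves where the place of one extreme value controls the occurrences.\<close>

lemma sum_permutations_insert:
  assumes "finite S" "m \<notin> S"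
  shows "(\<Sum>xs\<in>permutations_of_set (insert m S). h xs) =
    (\<Sum>ws\<in>permutations_of_set S. \<Sum>k\<le>card S. h (take k ws @ m # drop k ws))"
proof -
  let ?T = "permutations_of_set S \<times> {..card S}"
  let ?k = "\<lambda>xs. length (takeWhile (\<lambda>x. x \<noteq> m) xs)"
  have "(\<Sum>xs\<in>permutations_of_set (insert m S). h xs) = (\<Sum>(ws, k)\<in>?T. h (take k ws @ m # drop k ws))"
  proof (rule sum.reindex_bij_witness[where j = "\<lambda>xs. (remove1 m xs, ?k xs)"
        and i = "\<lambda>(ws, k). take k ws @ m # drop k ws"])
    fix xs assume xs: "xs \<in> permutations_of_set (insert m S)"
    then obtain ys zs where s: "xs = ys @ m # zs" "m \<notin> set ys"
      by (metis insertI1 permutations_of_setD(1) split_list_first)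
    then have tw: "remove1 m xs = ys @ zs" "?k xs = length ys"
      by (auto simp: takeWhile_append remove1_append)
    have S: "S = set ys \<union> set zs" "distinct (ys @ m # zs)"
      using xs s assms by (auto simp: permutations_of_set_def)
    then have "card S = length (ys @ zs)"
      by (metis distinct_append distinct.simps(2) distinct_card set_append Int_insert_right
          disjoint_insert(1) list.simps(15))
    with S show "(remove1 m xs, ?k xs) \<in> ?T"
      unfolding tw by (auto simp: permutations_of_set_def)
    show "(case (remove1 m xs, ?k xs) of (ws, k) \<Rightarrow> take k ws @ m # drop k ws) = xs"
      unfolding tw using s by simp
    show "(case (remove1 m xs, ?k xs) of (ws, k) \<Rightarrow> h (take k ws @ m # drop k ws)) = h xs"
      unfolding tw using s by simp
  next
    fix p assume "p \<in> ?T"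
    then obtain ws k where p: "p = (ws, k)" "set ws = S" "distinct ws" "k \<le> length ws"
      by (auto simp: permutations_of_set_def distinct_card)
    have m: "m \<notin> set (take k ws)" "m \<notin> set (drop k ws)"
      using p assms by (auto dest: in_set_takeD in_set_dropD)
    have "distinct (take k ws @ drop k ws)"
      using p by simp
    then have "distinct (take k ws @ m # drop k ws)"
      using m by (auto simp del: append_take_drop_id)
    moreover have "set (take k ws @ m # drop k ws) = insert m (set (take k ws @ drop k ws))"
      by (simp del: append_take_drop_id)
    ultimately show "(case p of (ws, k) \<Rightarrow> take k ws @ m # drop k ws) \<in> permutations_of_set (insert m S)"
      using p by (simp add: permutations_of_set_def)
    show "(\<lambda>xs. (remove1 m xs, ?k xs)) (case p of (ws, k) \<Rightarrow> take k ws @ m # drop k ws) = p"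
      using p m by (simp add: remove1_append takeWhile_append)
  qed
  then show ?thesis
    by (simp add: sum.cartesian_product)
qed

text \<open>\<open>A\<close> and \<open>B\<close> will be the value sets before and after the
  maximum; each pair forms an occurrence with the maximum between its members.\<close>

definition ascents :: "nat set \<Rightarrow> nat set \<Rightarrow> (nat \<times> nat) set" where
  "ascents A B = {(x, y). x \<in> A \<and> y \<in> B \<and> x < y}"

lemma finite_ascents: "finite A \<Longrightarrow> finite B \<Longrightarrow> finite (ascents A B)"
  by (rule finite_subset[of _ "A \<times> B"]) (auto simp: ascents_def)

lemma length_filter_distinct: "distinct xs \<Longrightarrow> length (filter P xs) = card {x \<in> set xs. P x}"
  by (metis distinct_card distinct_filter set_filter)

lemma card_ascents:
  "finite A \<Longrightarrow> finite B \<Longrightarrow> card (ascents A B) = (\<Sum>x\<in>A. card {y \<in> B. x < y})"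
proof -
  assume "finite A" "finite B"
  moreover have "ascents A B = (SIGMA x:A. {y \<in> B. x < y})"
    by (auto simp: ascents_def)
  ultimately show ?thesis
    by simp
qed

text \<open>Occurrences not inside one part are of three kinds: through \<open>m\<close>, which can
  only be the largest entry; one entry on the left and two on the right; two on the left and one on
  the right.\<close>

lemma occ_count_split:
  assumes "ys \<in> permutations_of_set A" "zs \<in> permutations_of_set B" "\<And>x. x \<in> A \<union> B \<Longrightarrow> x < m"
  shows "occ_count (ys @ m # zs) = occ_count ys + occ_count zs + card (ascents A B)
    + (\<Sum>x\<in>A. inv_count (filter (\<lambda>y. x < y) zs)) + (\<Sum>z\<in>B. straddle_count z ys)"
proof -
  have d: "set ys = A" "distinct ys" "set zs = B" "distinct zs"
    using assms by (auto simp: permutations_of_set_def)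
  then have fin: "finite A" "finite B"
    by auto
  have "straddle_count m ys = 0" if "\<forall>x\<in>set ys. x < m" for ys
    using that by (induction ys) (auto simp: filter_empty_conv)
  then have "straddle_count m ys = 0"
    using assms d by auto
  moreover have "filter (\<lambda>y. m < y) zs = []"
    using assms(3) d unfolding filter_empty_conv by (metis UnCI less_asym)
  moreover have "(\<Sum>x\<leftarrow>ys. inv_count (filter (\<lambda>y. x < y) (m # zs)))
      = (\<Sum>x\<leftarrow>ys. card {y \<in> B. x < y} + inv_count (filter (\<lambda>y. x < y) zs))"
  proof (intro arg_cong[of _ _ sum_list] map_cong refl)
    fix x assume "x \<in> set ys"
    then have "x < m"
      using assms d by auto
    moreover have "filter (\<lambda>y. y < m) (filter (\<lambda>y. x < y) zs) = filter (\<lambda>y. x < y) zs"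
      unfolding filter_filter using assms d by (intro filter_cong) auto
    ultimately show "inv_count (filter (\<lambda>y. x < y) (m # zs))
        = card {y \<in> B. x < y} + inv_count (filter (\<lambda>y. x < y) zs)"
      using d by (simp add: length_filter_distinct del: filter_filter)
  qed
  ultimately show ?thesis
    using d fin by (simp add: occ_count_append sum_list_distinct_conv_sum_set sum_list_addf card_ascents)
qed

text \<open>Every pair from \<open>A\<close> and \<open>B\<close> is an inversion or an ascent, and
  \<open>m\<close> is inverted with all of \<open>B\<close>. The ascents stand on the left side to
  avoid truncated subtraction.\<close>

lemma inv_count_split:
  assumes "ys \<in> permutations_of_set A" "zs \<in> permutations_of_set B" "\<And>x. x \<in> A \<union> B \<Longrightarrow> x < m"
    and "A \<inter> B = {}"
  shows "inv_count (ys @ m # zs) + card (ascents A B)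
    = inv_count ys + inv_count zs + card B * (1 + card A)"
proof -
  have d: "set ys = A" "distinct ys" "set zs = B" "distinct zs"
    using assms by (auto simp: permutations_of_set_def)
  then have fin: "finite A" "finite B"
    by auto
  have "inv_count (m # zs) = card B + inv_count zs"
    using assms d by (auto simp: filter_id_conv distinct_card[symmetric])
  moreover have "length (filter (\<lambda>y. y < x) (m # zs)) = card {y \<in> B. y < x}" if "x \<in> A" for x
    using that assms d by (force simp: length_filter_distinct)
  then have "(\<Sum>x\<leftarrow>ys. length (filter (\<lambda>y. y < x) (m # zs))) = (\<Sum>x\<in>A. card {y \<in> B. y < x})"
    using d by (simp add: sum_list_distinct_conv_sum_set cong: sum.cong)
  moreover have "card {y \<in> B. y < x} + card {y \<in> B. x < y} = card B" if "x \<in> A" for x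
  proof -
    have "{y \<in> B. y < x} \<union> {y \<in> B. x < y} = B"
      using that assms by (auto simp: neq_iff)
    moreover have "card ({y \<in> B. y < x} \<union> {y \<in> B. x < y}) = card {y \<in> B. y < x} + card {y \<in> B. x < y}"
      using fin by (intro card_Un_disjoint) auto
    ultimately show ?thesis
      by simp
  qed
  then have "(\<Sum>x\<in>A. card {y \<in> B. y < x}) + (\<Sum>x\<in>A. card {y \<in> B. x < y}) = card A * card B"
    unfolding sum.distrib[symmetric] by simp
  ultimately show ?thesis
    using fin by (simp add: inv_count_append card_ascents algebra_simps)
qed

section \<open>Insertion of a new minimum\<close>

lemma inv_count_insert_min:
  assumes "\<And>x. x \<in> set us \<union> set vs \<Longrightarrow> a < x"
  shows "inv_count (us @ a # vs) = inv_count (us @ vs) + length us"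
proof -
  have "(\<Sum>x\<leftarrow>us. length (filter (\<lambda>y. y < x) (a # vs))) = (\<Sum>x\<leftarrow>us. 1 + length (filter (\<lambda>y. y < x) vs))"
    using assms by (intro arg_cong[of _ _ sum_list] map_cong) auto
  moreover have "filter (\<lambda>y. y < a) vs = []"
    using assms by (force simp: filter_empty_conv)
  ultimately show ?thesis
    by (simp add: inv_count_append sum_list_Suc)
qed

lemma straddle_count_append:
  "straddle_count z (us @ vs) = straddle_count z us + straddle_count z vs
     + length (filter (\<lambda>x. x < z) us) * length (filter (\<lambda>y. z < y) vs)"
  by (induction us) (auto simp: algebra_simps)

lemma straddle_count_eq_0: "(\<And>x. x \<in> set xs \<Longrightarrow> z \<le> x) \<Longrightarrow> straddle_count z xs = 0"
  by (induction xs) (auto dest: leD)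

text \<open>A minimum can only be the first entry of an occurrence, so it adds one for each
  inversion after it.\<close>

lemma occ_count_insert_min:
  assumes "\<And>x. x \<in> set us \<union> set vs \<Longrightarrow> a < x"
  shows "occ_count (us @ a # vs) = occ_count (us @ vs) + inv_count vs"
proof -
  have "(\<Sum>x\<leftarrow>us. inv_count (filter (\<lambda>y. x < y) (a # vs))) = (\<Sum>x\<leftarrow>us. inv_count (filter (\<lambda>y. x < y) vs))"
    using assms by (intro arg_cong[of _ _ sum_list] map_cong) (auto dest: less_asym)
  moreover have "filter (\<lambda>y. a < y) vs = vs"
    using assms by (auto simp: filter_id_conv)
  moreover have "straddle_count a us = 0"
    using assms by (intro straddle_count_eq_0) (auto intro: less_imp_le)
  ultimately show ?thesis
    by (simp add: occ_count_append)
qed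

subsection \<open>Value sets with at most two ascents\<close>

text \<open>Without ascents \<open>A\<close> is upward closed in \<open>{..<n}\<close>, hence an
  upper interval; \<open>j = n\<close> gives the empty set.\<close>

lemma no_ascent_sets:
  "{A. A \<subseteq> {..<n} \<and> card (ascents A ({..<n} - A)) = 0} = (\<lambda>j. {j..<n}) ` {..n}"
proof (intro equalityI subsetI)
  fix A assume "A \<in> {A. A \<subseteq> {..<n} \<and> card (ascents A ({..<n} - A)) = 0}"
  then have A: "A \<subseteq> {..<n}" "ascents A ({..<n} - A) = {}"
    using finite_ascents[of A "{..<n} - A"] finite_subset[of A "{..<n}"] by auto
  then have up: "y \<in> A" if "x \<in> A" "x < y" "y < n" for x y
    using that by (auto simp: ascents_def)
  show "A \<in> (\<lambda>j. {j..<n}) ` {..n}"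
  proof (cases "A = {}")
    case True
    then show ?thesis by force
  next
    case False
    have fin: "finite A"
      using A finite_subset by blast
    have "A = {Min A..<n}"
    proof (intro equalityI subsetI)
      fix y assume "y \<in> {Min A..<n}"
      then show "y \<in> A"
        using up[OF Min_in[OF fin False], of y] Min_in[OF fin False] by (cases "y = Min A") auto
    qed (use A fin in auto)
    moreover have "Min A \<le> n"
      using A Min_in[OF fin False] by force
    ultimately show ?thesis
      by blast
  qed
next
  fix A assume "A \<in> (\<lambda>j. {j..<n}) ` {..n}"
  then obtain j where "A = {j..<n}" "j \<le> n"
    by auto
  moreover from this have "ascents A ({..<n} - A) = {}"
    by (auto simp: ascents_def)
  ultimately show "A \<in> {A. A \<subseteq> {..<n} \<and> card (ascents A ({..<n} - A)) = 0}"
    by auto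
qed

text \<open>A value strictly between the members of the ascent \<open>x < y\<close> would form a
  second ascent, with \<open>y\<close> if it lies in \<open>A\<close> and with \<open>x\<close>
  otherwise. So \<open>y = x + 1\<close>; all larger values are in \<open>A\<close> and all smaller
  ones are not.\<close>

lemma one_ascent_sets:
  "{A. A \<subseteq> {..<n} \<and> card (ascents A ({..<n} - A)) = 1} = (\<lambda>a. insert a {a + 2..<n}) ` {..<n - 1}"
proof (intro equalityI subsetI)
  fix A assume A: "A \<in> {A. A \<subseteq> {..<n} \<and> card (ascents A ({..<n} - A)) = 1}"
  then obtain x y where p: "ascents A ({..<n} - A) = {(x, y)}"
    by (auto simp: card_1_singleton_iff)
  then have xy: "x \<in> A" "y \<notin> A" "y < n" "x < y"
    by (auto simp: ascents_def set_eq_iff)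
  have only: "s = x \<and> t = y" if "s \<in> A" "t < n" "t \<notin> A" "s < t" for s t
    using that p by (auto simp: ascents_def set_eq_iff)
  have "\<not> x + 1 < y"
    using only[of "x + 1" y] only[of x "x + 1"] xy by (cases "x + 1 \<in> A") auto
  with xy have y: "y = x + 1"
    by simp
  have "A = insert x {x + 2..<n}"
  proof (intro equalityI subsetI)
    fix t assume t: "t \<in> A"
    then have "t < n" "t \<noteq> y" "\<not> t < x"
      using A xy only[of t y] by auto
    then show "t \<in> insert x {x + 2..<n}"
      using y by auto
  next
    fix t assume "t \<in> insert x {x + 2..<n}"
    then show "t \<in> A"
      using xy y only[of x t] by (cases "t \<in> A") auto
  qed
  moreover have "x < n - 1"
    using xy y by auto
  ultimately show "A \<in> (\<lambda>a. insert a {a + 2..<n}) ` {..<n - 1}"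
    by blast
next
  fix A assume "A \<in> (\<lambda>a. insert a {a + 2..<n}) ` {..<n - 1}"
  then obtain a where a: "A = insert a {a + 2..<n}" "a < n - 1"
    by auto
  then have "ascents A ({..<n} - A) = {(a, a + 1)}"
    by (auto simp: ascents_def)
  then have "card (ascents A ({..<n} - A)) = 1"
    by simp
  moreover have "A \<subseteq> {..<n}"
    using a by auto
  ultimately show "A \<in> {A. A \<subseteq> {..<n} \<and> card (ascents A ({..<n} - A)) = 1}"
    by blast
qed

text \<open>Two ascents must share their lower or their upper member, and again no further value
  fits between. Either \<open>a\<close> is in \<open>A\<close> and \<open>a + 1\<close>,
  \<open>a + 2\<close> are not, or \<open>a\<close>, \<open>a + 1\<close> are in \<open>A\<close>
  and \<open>a + 2\<close> is not.\<close>

lemma two_ascents_sets: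
  "{A. A \<subseteq> {..<n} \<and> card (ascents A ({..<n} - A)) = 2}
    = (\<lambda>a. insert a {a + 3..<n}) ` {..<n - 2}
      \<union> (\<lambda>a. insert a (insert (a + 1) {a + 3..<n})) ` {..<n - 2}"
proof (intro equalityI subsetI)
  fix A assume A: "A \<in> {A. A \<subseteq> {..<n} \<and> card (ascents A ({..<n} - A)) = 2}"
  then obtain p q where "ascents A ({..<n} - A) = {p, q}" "p \<noteq> q"
    by (auto simp: card_2_iff)
  moreover obtain x' y' u' v' where "p = (x', y')" "q = (u', v')"
    by (metis surj_pair)
  \<comment> \<open>Ordering the two pairs lexicographically halves the cases.\<close>
  ultimately obtain x y u v where p: "ascents A ({..<n} - A) = {(x, y), (u, v)}"
    and less: "x < u \<or> x = u \<and> y < v"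
    by (metis insert_commute linorder_neqE_nat)
  have "(x, y) \<in> ascents A ({..<n} - A)" "(u, v) \<in> ascents A ({..<n} - A)"
    unfolding p by auto
  then have xy: "x \<in> A" "y \<notin> A" "y < n" "x < y" and uv: "u \<in> A" "v \<notin> A" "v < n" "u < v"
    by (auto simp: ascents_def)
  have only: "s = x \<and> t = y \<or> s = u \<and> t = v" if "s \<in> A" "t < n" "t \<notin> A" "s < t" for s t
  proof -
    have "(s, t) \<in> ascents A ({..<n} - A)"
      using that by (auto simp: ascents_def)
    then show ?thesis
      unfolding p by auto
  qed
  consider "x = u" "y < v" | "x < u"
    using less by auto
  then show "A \<in> (\<lambda>a. insert a {a + 3..<n}) ` {..<n - 2}
      \<union> (\<lambda>a. insert a (insert (a + 1) {a + 3..<n})) ` {..<n - 2}"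
  proof cases
    case 1
    have "\<not> x + 1 < y"
      using only[of "x + 1" y] only[of x "x + 1"] xy 1 by (cases "x + 1 \<in> A") auto
    with xy have y: "y = x + 1"
      by simp
    have "\<not> x + 2 < v"
      using only[of "x + 2" v] only[of x "x + 2"] xy uv 1 y by (cases "x + 2 \<in> A") auto
    with y 1 have v: "v = x + 2"
      by simp
    have "A = insert x {x + 3..<n}"
    proof (intro equalityI subsetI)
      fix t assume t: "t \<in> A"
      then have "t < n" "t \<noteq> y" "t \<noteq> v" "\<not> t < x"
        using A xy uv 1 only[of t y] by auto
      then show "t \<in> insert x {x + 3..<n}"
        using y v by auto
    next
      fix t assume "t \<in> insert x {x + 3..<n}"
      then show "t \<in> A"
        using xy y v only[of x t] by (cases "t \<in> A") auto
    qed
    moreover have "x < n - 2"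
      using uv v by auto
    ultimately show ?thesis
      by blast
  next
    case 2
    \<comment> \<open>Here \<open>x < u < v\<close>, so \<open>(x, v)\<close> is an ascent as well;
      it differs from \<open>(u, v)\<close> and must be \<open>(x, y)\<close>.\<close>
    have v: "v = y"
      using only[of x v] xy uv 2 by auto
    have "\<not> x + 1 < u"
      using only[of "x + 1" v] only[of x "x + 1"] xy uv 2 v by (cases "x + 1 \<in> A") auto
    with 2 have u: "u = x + 1"
      by simp
    have "\<not> x + 2 < y"
      using only[of "x + 2" v] only[of u "x + 2"] xy uv 2 v u by (cases "x + 2 \<in> A") auto
    with uv v u have y: "y = x + 2"
      by simp
    have "A = insert x (insert (x + 1) {x + 3..<n})"
    proof (intro equalityI subsetI)
      fix t assume t: "t \<in> A"
      then have "t < n" "t \<noteq> y" "\<not> t < x"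
        using A xy uv 2 only[of t y] by auto
      then show "t \<in> insert x (insert (x + 1) {x + 3..<n})"
        using y by auto
    next
      fix t assume "t \<in> insert x (insert (x + 1) {x + 3..<n})"
      then show "t \<in> A"
        using xy uv u v y only[of x t] by (cases "t \<in> A") auto
    qed
    moreover have "x < n - 2"
      using xy y by auto
    ultimately show ?thesis
      by blast
  qed
next
  fix A assume "A \<in> (\<lambda>a. insert a {a + 3..<n}) ` {..<n - 2}
      \<union> (\<lambda>a. insert a (insert (a + 1) {a + 3..<n})) ` {..<n - 2}"
  then obtain a where a: "a < n - 2"
    and "A = insert a {a + 3..<n} \<or> A = insert a (insert (a + 1) {a + 3..<n})"
    by auto
  then show "A \<in> {A. A \<subseteq> {..<n} \<and> card (ascents A ({..<n} - A)) = 2}"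
  proof (elim disjE)
    assume A: "A = insert a {a + 3..<n}"
    with a have "ascents A ({..<n} - A) = {(a, a + 1), (a, a + 2)}"
      by (auto simp: ascents_def)
    then have "card (ascents A ({..<n} - A)) = 2"
      by simp
    moreover have "A \<subseteq> {..<n}"
      using a A by auto
    ultimately show ?thesis
      by blast
  next
    assume A: "A = insert a (insert (a + 1) {a + 3..<n})"
    with a have "ascents A ({..<n} - A) = {(a, a + 2), (a + 1, a + 2)}"
      by (auto simp: ascents_def)
    then have "card (ascents A ({..<n} - A)) = 2"
      by simp
    moreover have "A \<subseteq> {..<n}"
      using a A by auto
    ultimately show ?thesis
      by blast
  qed
qed

lemma inj_on_low_set:
  "inj_on (\<lambda>a. insert a {a + c..<n}) I" if "c > 0" for c n :: nat
proof (rule inj_onI)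
  fix a b assume "insert a {a + c..<n} = insert b {b + c..<n}"
  then have "a \<in> insert b {b + c..<n}" "b \<in> insert a {a + c..<n}"
    by blast+
  then show "a = b"
    by auto
qed

lemma inj_on_two_low_set:
  "inj_on (\<lambda>a::nat. insert a (insert (a + 1) {a + 3..<n})) I"
proof (rule inj_onI)
  fix a b assume "insert a (insert (a + 1) {a + 3..<n}) = insert b (insert (b + 1) {b + 3..<n})"
  then have "a \<in> insert b (insert (b + 1) {b + 3..<n})" "b \<in> insert a (insert (a + 1) {a + 3..<n})"
    by blast+
  then show "a = b"
    by auto
qed

subsection \<open>Weighted sums over permutations\<close>

lemma sum_sum_mult:
  fixes c :: "'a::comm_semiring_0"
  shows "(\<Sum>x\<in>A. \<Sum>y\<in>B. c * f x * g y) = c * sum f A * sum g B"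
  unfolding mult.assoc sum_product by (simp only: sum_distrib_left)

text \<open>The series variable marks occurrences of 132 here, whereas it marks the length in \<open>occ_series\<close> below.\<close>

definition weight :: "rat \<Rightarrow> nat list \<Rightarrow> rat fps" where
  "weight e xs = fps_const (e ^ inv_count xs) * X ^ occ_count xs"

definition weight_sum :: "rat \<Rightarrow> nat set \<Rightarrow> rat fps" where
  "weight_sum e S = (\<Sum>xs\<in>permutations_of_set S. weight e xs)"

text \<open>For \<open>e = 1\<close> this counts the permutations of length \<open>n\<close> with
  \<open>r\<close> occurrences; for \<open>e = -1\<close> it is the number of even ones minus the
  number of odd ones.\<close>

definition occ_coef :: "rat \<Rightarrow> nat \<Rightarrow> nat \<Rightarrow> rat" where
  "occ_coef e r n = weight_sum e {..<n} $ r"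

text \<open>Inversions and occurrences depend only on relative order, so the increasing relabelling
  preserves weights.\<close>

lemma weight_sum_card:
  assumes "finite S"
  shows "weight_sum e S = weight_sum e {..<card S}"
proof -
  obtain h where h: "bij_betw h {..<card S} S" "strict_mono_on {..<card S} h"
    using ex_bij_betw_strict_mono_card[OF assms] .
  then have inj: "inj_on h {..<card S}" and S: "S = h ` {..<card S}"
    by (auto simp: bij_betw_def)
  have "permutations_of_set S = map h ` permutations_of_set {..<card S}"
    by (subst S) (rule permutations_of_set_image_inj[OF inj])
  moreover have "inj_on (map h) (permutations_of_set {..<card S})"
    using inj by (intro inj_on_mapI) simp
  moreover have "weight e (map h xs) = weight e xs" if "xs \<in> permutations_of_set {..<card S}" for xs
    using that h(2) by (simp add: weight_def permutations_of_set_def inv_count_map occ_count_map)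
  ultimately show ?thesis
    by (simp add: weight_sum_def sum.reindex)
qed

lemma weight_sum_nth: "finite S \<Longrightarrow> weight_sum e S $ r = occ_coef e r (card S)"
  unfolding occ_coef_def by (subst weight_sum_card) auto

section \<open>Weights of a permutation split at its maximum\<close>

locale sign_weight =
  fixes e :: rat
  assumes square: "e * e = 1"
begin

lemma power_double: "e ^ (m + 2 * k) = e ^ m"
  using square by (simp add: power_add power_mult power2_eq_square)

text \<open>Since \<open>e\<close> is a sign, all later bookkeeping of its exponents is done modulo
  2.\<close>

lemma power_cong_parity: "even (m + k) \<Longrightarrow> e ^ m = e ^ k"
proof -
  assume "even (m + k)"
  have even: "e ^ i = 1" if "even i" for i
    using power_double[of 0] that by (auto elim!: evenE)
  have odd: "e ^ i = e" if "odd i" for i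
    using power_double[of 1] that by (auto elim!: oddE simp: power_add)
  from \<open>even (m + k)\<close> show ?thesis
    by (cases "even m") (auto simp: even odd)
qed

text \<open>The exponent of \<open>e\<close> adds the number of ascents where the inversion count
  subtracts it; the parity is the same.\<close>

lemma weight_split:
  assumes "ys \<in> permutations_of_set A" "zs \<in> permutations_of_set B" "\<And>x. x \<in> A \<union> B \<Longrightarrow> x < m"
    and "A \<inter> B = {}"
  shows "weight e (ys @ m # zs) =
    fps_const (e ^ (card B * (1 + card A) + card (ascents A B)))
    * X ^ (card (ascents A B) + (\<Sum>x\<in>A. inv_count (filter (\<lambda>y. x < y) zs)) + (\<Sum>z\<in>B. straddle_count z ys))
    * weight e ys * weight e zs"
proof -
  have "even (inv_count (ys @ m # zs)
      + (inv_count ys + inv_count zs + (card B * (1 + card A) + card (ascents A B))))"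
    using arg_cong[OF inv_count_split[OF assms], of even] by auto
  then have *: "e ^ inv_count (ys @ m # zs)
      = e ^ (inv_count ys + inv_count zs + (card B * (1 + card A) + card (ascents A B)))"
    by (rule power_cong_parity)
  have **: "occ_count (ys @ m # zs) = occ_count ys + occ_count zs + card (ascents A B)
      + (\<Sum>x\<in>A. inv_count (filter (\<lambda>y. x < y) zs)) + (\<Sum>z\<in>B. straddle_count z ys)"
    using assms by (intro occ_count_split) auto
  show ?thesis
    unfolding weight_def * **
    by (simp only: power_add fps_const_mult[symmetric] ac_simps)
qed

definition split_sum :: "nat \<Rightarrow> nat set \<Rightarrow> rat fps" where
  "split_sum n A = (\<Sum>ys\<in>permutations_of_set A. \<Sum>zs\<in>permutations_of_set ({..<n} - A). weight e (ys @ n # zs))"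

lemma weight_sum_Suc: "weight_sum e {..<Suc n} = (\<Sum>A\<in>Pow {..<n}. split_sum n A)"
  unfolding weight_sum_def lessThan_Suc split_sum_def by (rule sum_permutations_split) auto

text \<open>Every ascent costs an occurrence, so coefficient \<open>r\<close> only sees value sets
  with at most \<open>r\<close> ascents.\<close>

lemma split_sum_nth_eq_0:
  assumes "A \<subseteq> {..<n}" "r < card (ascents A ({..<n} - A))"
  shows "split_sum n A $ r = 0"
proof -
  have "weight e (ys @ n # zs) $ r = 0"
    if "ys \<in> permutations_of_set A" "zs \<in> permutations_of_set ({..<n} - A)" for ys zs
  proof -
    have "card (ascents A ({..<n} - A)) \<le> occ_count (ys @ n # zs)"
      using assms by (subst occ_count_split[OF that]) auto
    with assms show ?thesis
      by (simp add: weight_def fps_X_power_mult_right_nth)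
  qed
  then show ?thesis
    by (simp add: split_sum_def fps_sum_nth)
qed

lemma weight_sum_Suc_nth:
  "weight_sum e {..<Suc n} $ r =
    (\<Sum>d\<le>r. \<Sum>A | A \<subseteq> {..<n} \<and> card (ascents A ({..<n} - A)) = d. split_sum n A $ r)"
proof -
  let ?d = "\<lambda>A. card (ascents A ({..<n} - A))"
  have "weight_sum e {..<Suc n} $ r = (\<Sum>A\<in>Pow {..<n}. split_sum n A $ r)"
    by (simp add: weight_sum_Suc fps_sum_nth)
  also have "\<dots> = (\<Sum>A\<in>{A \<in> Pow {..<n}. ?d A \<le> r}. split_sum n A $ r)"
    by (rule sum.mono_neutral_right) (auto simp: split_sum_nth_eq_0 not_le)
  also have "\<dots> = (\<Sum>d\<le>r. \<Sum>A\<in>{A \<in> {A \<in> Pow {..<n}. ?d A \<le> r}. ?d A = d}. split_sum n A $ r)"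
    by (rule sum.group[symmetric]) auto
  also have "\<dots> = (\<Sum>d\<le>r. \<Sum>A | A \<subseteq> {..<n} \<and> ?d A = d. split_sum n A $ r)"
    by (intro sum.cong arg_cong2[of _ _ _ _ sum] refl) auto
  finally show ?thesis .
qed

text \<open>Every value on the left exceeds every value on the right, so no occurrence crosses and
  the weight factors. The sign comes from the \<open>j\<close> right values, each below the maximum
  and below all \<open>n - j\<close> left values.\<close>

lemma split_sum_no_ascent:
  assumes "j \<le> n"
  shows "split_sum n {j..<n} =
    fps_const (e ^ (j * (1 + (n - j)))) * weight_sum e {j..<n} * weight_sum e {..<j}"
proof -
  have B: "{..<n} - {j..<n} = {..<j}"
    using assms by auto
  have "weight e (ys @ n # zs) = fps_const (e ^ (j * (1 + (n - j)))) * weight e ys * weight e zs"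
    if "ys \<in> permutations_of_set {j..<n}" "zs \<in> permutations_of_set {..<j}" for ys zs
  proof -
    have a: "ascents {j..<n} {..<j} = {}"
      by (auto simp: ascents_def)
    have "filter (\<lambda>y. x < y) zs = []" if "x \<in> {j..<n}" for x
      using \<open>zs \<in> _\<close> that by (auto simp: filter_empty_conv permutations_of_set_def)
    moreover have "straddle_count z ys = 0" if "z \<in> {..<j}" for z
      using \<open>ys \<in> _\<close> that by (intro straddle_count_eq_0) (auto simp: permutations_of_set_def)
    ultimately show ?thesis
      using weight_split[OF that, of n] assms a by force
  qed
  then show ?thesis
    unfolding split_sum_def B weight_sum_def sum_sum_mult[symmetric] by (intro sum.cong refl)
qed

text \<open>Split sets whose ascents all start at one value \<open>a\<close>: the factor over the left part records the
  position of \<open>a\<close>, the factor over the right part the inversions among the values exceeding \<open>a\<close>.\<close>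

lemma split_sum_one_low:
  assumes A: "A = insert a S" "a \<notin> S" "A \<subseteq> {..<n}" and B: "B = {..<n} - A" "finite S"
    and le: "\<And>x z. x \<in> S \<Longrightarrow> z \<in> B \<Longrightarrow> z < x"
    and d: "card {z \<in> B. a < z} = d"
  shows "split_sum n A = fps_const (e ^ (card B * (2 + card S) + d)) * X ^ d
    * (\<Sum>ws\<in>permutations_of_set S. \<Sum>k\<le>card S.
         X ^ (d * (card S - k)) * weight e (take k ws @ a # drop k ws))
    * (\<Sum>zs\<in>permutations_of_set B. X ^ inv_count (filter (\<lambda>y. a < y) zs) * weight e zs)"
proof -
  have fin: "finite A" "finite B"
    using A B by auto
  have disj: "A \<inter> B = {}"
    using B by auto
  have "ascents A B = Pair a ` {z \<in> B. a < z}"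
    using A le by (auto simp: ascents_def dest: less_asym)
  then have a: "card (ascents A B) = d"
    using d by (simp add: card_image inj_on_def)
  have cA: "1 + card A = 2 + card S"
    using A B by simp
  have *: "weight e (ys @ n # zs) = fps_const (e ^ (card B * (2 + card S) + d)) * X ^ d
      * (X ^ (\<Sum>z\<in>B. straddle_count z ys) * weight e ys)
      * (X ^ inv_count (filter (\<lambda>y. a < y) zs) * weight e zs)"
    if "ys \<in> permutations_of_set A" "zs \<in> permutations_of_set B" for ys zs
  proof -
    have "filter (\<lambda>y. x < y) zs = []" if "x \<in> S" for x
      using \<open>zs \<in> _\<close> that le[of x] by (auto simp: filter_empty_conv permutations_of_set_def dest: less_asym)
    then have "(\<Sum>x\<in>A. inv_count (filter (\<lambda>y. x < y) zs)) = inv_count (filter (\<lambda>y. a < y) zs)"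
      using A B by simp
    moreover have "x < n" if "x \<in> A \<union> B" for x
      using that A B by auto
    note weight_split[OF that this disj]
    ultimately show ?thesis
      unfolding a cA by (simp only: power_add ac_simps)
  qed
  \<comment> \<open>All of \<open>B\<close> lies below \<open>S\<close>, and \<open>d\<close> values
    of \<open>B\<close> exceed \<open>a\<close>. Each of these is straddled by \<open>a\<close>
    together with any of the \<open>card S - k\<close> entries after it.\<close>
  have **: "(\<Sum>z\<in>B. straddle_count z (take k ws @ a # drop k ws)) = d * (card S - k)"
    if "ws \<in> permutations_of_set S" "k \<le> card S" for ws k
  proof -
    have ws: "set ws = S" "length ws = card S"
      using that by (auto simp: permutations_of_set_def distinct_card)
    have sub: "x \<in> S" if "x \<in> set (take k ws) \<union> set (drop k ws)" for x
      using that ws by (auto dest: in_set_takeD in_set_dropD)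
    have "straddle_count z (take k ws @ a # drop k ws) = (if a < z then card S - k else 0)"
      if "z \<in> B" for z
    proof -
      have "filter (\<lambda>x. x < z) (take k ws) = []"
        using sub le[OF _ that] by (auto simp: filter_empty_conv dest: less_asym)
      moreover have "straddle_count z (take k ws) = 0" "straddle_count z (drop k ws) = 0"
        using sub le[OF _ that] by (auto intro!: straddle_count_eq_0 less_imp_le)
      moreover have "filter (\<lambda>y. z < y) (drop k ws) = drop k ws"
        using sub le[OF _ that] by (auto simp: filter_id_conv)
      ultimately show ?thesis
        using ws by (simp add: straddle_count_append)
    qed
    then have "(\<Sum>z\<in>B. straddle_count z (take k ws @ a # drop k ws))
        = (\<Sum>z\<in>B. if a < z then card S - k else 0)"
      by simp
    also have "\<dots> = d * (card S - k)"
      using fin d by (simp add: sum.If_cases Int_def)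
    finally show ?thesis .
  qed
  have "split_sum n A = fps_const (e ^ (card B * (2 + card S) + d)) * X ^ d
    * (\<Sum>ys\<in>permutations_of_set A. X ^ (\<Sum>z\<in>B. straddle_count z ys) * weight e ys)
    * (\<Sum>zs\<in>permutations_of_set B. X ^ inv_count (filter (\<lambda>y. a < y) zs) * weight e zs)"
    unfolding split_sum_def B(1)[symmetric] sum_sum_mult[symmetric] by (intro sum.cong refl *)
  also have "(\<Sum>ys\<in>permutations_of_set A. X ^ (\<Sum>z\<in>B. straddle_count z ys) * weight e ys)
    = (\<Sum>ws\<in>permutations_of_set S. \<Sum>k\<le>card S.
         X ^ (d * (card S - k)) * weight e (take k ws @ a # drop k ws))"
    unfolding A(1) using A(2) B(2) ** by (subst sum_permutations_insert) (auto intro!: sum.cong)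
  finally show ?thesis .
qed

lemma weight_insert_min:
  assumes "\<And>x. x \<in> set ws \<Longrightarrow> a < x" "k \<le> length ws"
  shows "weight e (take k ws @ a # drop k ws) = fps_const (e ^ k) * X ^ inv_count (drop k ws) * weight e ws"
proof -
  have "a < x" if "x \<in> set (take k ws) \<union> set (drop k ws)" for x
    using that assms by (auto dest: in_set_takeD in_set_dropD)
  note inv_count_insert_min[OF this] occ_count_insert_min[OF this]
  then show ?thesis
    using assms by (simp add: weight_def power_add fps_const_mult[symmetric] mult_ac del: fps_const_mult)
qed

text \<open>A constant term allows nothing after \<open>a\<close>. Only the position
  \<open>k = card S\<close> survives, where \<open>a\<close> is inverted with all of
  \<open>S\<close>.\<close>

lemma insert_min_sum_nth_0:
  assumes "finite S" "\<And>x. x \<in> S \<Longrightarrow> a < x" "d > 0"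
  shows "(\<Sum>ws\<in>permutations_of_set S. \<Sum>k\<le>card S.
         X ^ (d * (card S - k)) * weight e (take k ws @ a # drop k ws)) $ 0 = e ^ card S * occ_coef e 0 (card S)"
proof -
  have "(\<Sum>k\<le>card S. (X ^ (d * (card S - k)) * weight e (take k ws @ a # drop k ws)) $ 0)
      = e ^ card S * weight e ws $ 0"
    if "ws \<in> permutations_of_set S" for ws
  proof -
    have ws: "set ws = S" "length ws = card S"
      using that by (auto simp: permutations_of_set_def distinct_card)
    have "(\<Sum>k\<le>card S. (X ^ (d * (card S - k)) * weight e (take k ws @ a # drop k ws)) $ 0)
       = (\<Sum>k\<in>{card S}. (X ^ (d * (card S - k)) * weight e (take k ws @ a # drop k ws)) $ 0)"
      using assms by (intro sum.mono_neutral_right) (auto simp: fps_X_power_mult_nth)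
    also have "\<dots> = e ^ card S * weight e ws $ 0"
      using assms ws weight_insert_min[of ws a "length ws"] by simp
    finally show ?thesis .
  qed
  then show ?thesis
    using assms by (simp add: fps_sum_nth weight_sum_nth[symmetric] weight_sum_def sum_distrib_left)
qed

text \<open>Two positions reach degree 1: \<open>a\<close> last, or \<open>a\<close> followed by a
  single entry, which costs exactly one factor \<open>X\<close>. Positions further left cost at
  least two.\<close>

lemma insert_min_sum_nth_1:
  assumes "finite S" "\<And>x. x \<in> S \<Longrightarrow> a < x"
  shows "(\<Sum>ws\<in>permutations_of_set S. \<Sum>k\<le>card S.
         X ^ (1 * (card S - k)) * weight e (take k ws @ a # drop k ws)) $ 1
    = e ^ card S * occ_coef e 1 (card S) + (if S = {} then 0 else e ^ (card S - 1) * occ_coef e 0 (card S))"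
proof -
  have "(\<Sum>k\<le>card S. (X ^ (1 * (card S - k)) * weight e (take k ws @ a # drop k ws)) $ 1)
      = e ^ card S * weight e ws $ 1 + (if S = {} then 0 else e ^ (card S - 1) * weight e ws $ 0)"
    if "ws \<in> permutations_of_set S" for ws
  proof -
    let ?f = "\<lambda>k. (X ^ (1 * (card S - k)) * weight e (take k ws @ a # drop k ws)) $ 1"
    have ws: "set ws = S" "length ws = card S"
      using that by (auto simp: permutations_of_set_def distinct_card)
    have top: "?f (card S) = e ^ card S * weight e ws $ 1"
      using assms ws weight_insert_min[of ws a "length ws"] by simp
    show ?thesis
    proof (cases "S = {}")
      case True
      with top show ?thesis by simp
    next
      case False
      then have pos: "card S > 0"
        using assms by (simp add: card_gt_0_iff)
      \<comment> \<open>One entry follows \<open>a\<close>, so \<open>a\<close> starts no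
        occurrence.\<close>
      have "inv_count (drop (card S - 1) ws) = 0"
        using pos ws by (simp add: inv_count_eq_0_iff sorted01)
      then have next_top: "?f (card S - 1) = e ^ (card S - 1) * weight e ws $ 0"
        using assms ws pos weight_insert_min[of ws a "card S - 1"] by simp
      have "(\<Sum>k\<le>card S. ?f k) = (\<Sum>k\<in>{card S - 1, card S}. ?f k)"
        using assms by (intro sum.mono_neutral_right) (auto simp: fps_X_power_mult_nth)
      with pos False top next_top show ?thesis
        by simp
    qed
  qed
  then have "(\<Sum>ws\<in>permutations_of_set S. \<Sum>k\<le>card S.
         X ^ (1 * (card S - k)) * weight e (take k ws @ a # drop k ws)) $ 1 =
    (\<Sum>ws\<in>permutations_of_set S. e ^ card S * weight e ws $ 1
       + (if S = {} then 0 else e ^ (card S - 1) * weight e ws $ 0))"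
    by (simp add: fps_sum_nth)
  then show ?thesis
    using assms by (simp add: fps_sum_nth weight_sum_nth[symmetric] weight_sum_def sum_distrib_left sum.distrib)
qed

end

lemma straddle_count_insert_min:
  "a < z \<Longrightarrow> straddle_count z (us @ a # vs) = straddle_count z (us @ vs) + length (filter (\<lambda>y. z < y) vs)"
  by (auto simp: straddle_count_append)

context sign_weight
begin

text \<open>To avoid straddling \<open>z\<close>, all of \<open>S\<close> must precede
  \<open>a\<close> and \<open>b\<close>. Two endings remain, \<open>a b\<close> and
  \<open>b a\<close>; the inversions with \<open>S\<close> are even in number, so the endings
  contribute the factors \<open>1\<close> and \<open>e\<close>.\<close>

lemma insert_two_min_sum_nth_0:
  assumes "finite S" "a < b" "b < z" "\<And>x. x \<in> S \<Longrightarrow> z < x"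
  shows "(\<Sum>ys\<in>permutations_of_set (insert a (insert b S)). X ^ straddle_count z ys * weight e ys) $ 0
    = (1 + e) * occ_coef e 0 (card S)"
proof -
  let ?T = "insert b S"
  let ?g = "\<lambda>xs k. X ^ straddle_count z (take k xs @ a # drop k xs) * weight e (take k xs @ a # drop k xs)"
  let ?h = "\<lambda>xs. (\<Sum>k\<le>card ?T. ?g xs k $ 0)"
  have card: "card ?T = Suc (card S)" and a: "a \<notin> ?T" and b: "b \<notin> S"
    using assms by (force intro: card_insert_disjoint)+
  have low: "?h (take l ws @ b # drop l ws) = (if l = card S then (1 + e) * weight e ws $ 0 else 0)"
    if "ws \<in> permutations_of_set S" "l \<le> card S" for ws l
  proof -
    have ws: "set ws = S" "length ws = card S"
      using that by (auto simp: permutations_of_set_def distinct_card)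
    have big: "filter (\<lambda>y. z < y) (drop i ws) = drop i ws" for i
      using assms ws by (auto simp: filter_id_conv dest: in_set_dropD)
    show ?thesis
    proof (cases "l = card S")
      case False
      \<comment> \<open>Some entry of \<open>S\<close> follows \<open>b\<close>, and the two
        straddle \<open>z\<close>; inserting \<open>a\<close> cannot undo this.\<close>
      have "straddle_count z (take l ws @ b # drop l ws) > 0"
        using False that(2) ws big[of l] assms by (simp add: straddle_count_insert_min)
      then have zero: "?g (take l ws @ b # drop l ws) k $ 0 = 0" for k
        using straddle_count_insert_min[OF less_trans[OF assms(2,3)],
            of "take k (take l ws @ b # drop l ws)" "drop k (take l ws @ b # drop l ws)"]
        by (simp only: append_take_drop_id fps_X_power_mult_nth) simp
      show ?thesis
        using False by (simp only: zero if_False sum.neutral_const)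
    next
      case True
      let ?xs = "ws @ [b]"
      have xs: "take l ws @ b # drop l ws = ?xs"
        using True ws by simp
      have gt: "a < x" if "x \<in> set ?xs" for x
        using that ws assms by force
      have "straddle_count z ws = 0"
        using assms ws by (intro straddle_count_eq_0) (auto intro: less_imp_le)
      then have s: "straddle_count z ?xs = 0"
        using assms by (auto simp: straddle_count_append)
      have w: "weight e ?xs = fps_const (e ^ card S) * weight e ws"
        using weight_insert_min[of ws b "length ws"] assms ws by force
      have g: "?g ?xs k $ 0 = (if k < card S then 0 else e ^ k * e ^ card S * weight e ws $ 0)"
        if "k \<le> Suc (card S)" for k
      proof (cases "k < card S")
        case True
        then have "filter (\<lambda>y. z < y) (drop k ?xs) \<noteq> []"
          using ws big[of k] by simp
        then have "straddle_count z (take k ?xs @ a # drop k ?xs) > 0"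
          using assms by (subst straddle_count_insert_min) auto
        with True show ?thesis
          by (simp add: fps_X_power_mult_nth)
      next
        case False
        \<comment> \<open>At most \<open>b\<close> follows \<open>a\<close>, so \<open>a\<close>
          starts no occurrence and has no partner above \<open>z\<close>.\<close>
        then have "length (drop k ?xs) \<le> 1" "filter (\<lambda>y. z < y) (drop k ?xs) = []"
          using ws assms by (auto simp: drop_Cons')
        then have "inv_count (drop k ?xs) = 0" "straddle_count z (take k ?xs @ a # drop k ?xs) = 0"
          using assms s unfolding inv_count_eq_0_iff
          by (auto intro: sorted01 simp: straddle_count_insert_min simp del: drop_append take_append)
        then show ?thesis
          using False that ws weight_insert_min[of ?xs a k] gt
          by (simp add: w del: drop_append take_append)
      qed
      have "?h ?xs = (\<Sum>k\<in>{card S, Suc (card S)}. ?g ?xs k $ 0)"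
        unfolding card using g by (intro sum.mono_neutral_right) auto
      also have "\<dots> = e ^ card S * e ^ card S * weight e ws $ 0
          + e * (e ^ card S * e ^ card S) * weight e ws $ 0"
        using g[of "card S"] g[of "Suc (card S)"]
        by (simp add: mult.assoc del: drop_append take_append)
      also have "e ^ card S * e ^ card S = 1"
        using power_double[of 0 "card S"] by (simp add: mult_2 power_add)
      also have "1 * weight e ws $ 0 + e * 1 * weight e ws $ 0 = (1 + e) * weight e ws $ 0"
        by (simp add: algebra_simps)
      finally show ?thesis
        using True xs by simp
    qed
  qed
  have "(\<Sum>ys\<in>permutations_of_set (insert a ?T). X ^ straddle_count z ys * weight e ys) $ 0
    = (\<Sum>xs\<in>permutations_of_set ?T. ?h xs)"
    using a assms by (subst sum_permutations_insert) (simp_all only: finite_insert fps_sum_nth not_False_eq_True)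
  also have "\<dots> = (\<Sum>ws\<in>permutations_of_set S. \<Sum>l\<le>card S. ?h (take l ws @ b # drop l ws))"
    using b assms by (rule_tac sum_permutations_insert)
  also have "\<dots> = (\<Sum>ws\<in>permutations_of_set S. \<Sum>l\<le>card S. (if l = card S then (1 + e) * weight e ws $ 0 else 0))"
    using low by (intro sum.cong refl) blast
  also have "\<dots> = (1 + e) * occ_coef e 0 (card S)"
    using assms by (simp add: weight_sum_nth[symmetric] weight_sum_def fps_sum_nth sum_distrib_left)
  finally show ?thesis .
qed

text \<open>The ascents \<open>(a, z)\<close> and \<open>(b, z)\<close> already use up degree 2, so
  the remaining factors enter only by their constant terms.\<close>

lemma split_sum_two_low:
  assumes A: "A = insert a (insert b S)" "A \<subseteq> {..<n}" and B: "B = {..<n} - A" "finite S"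
    and z: "z \<in> B" "a < b" "b < z" "\<And>x. x \<in> S \<Longrightarrow> z < x" "\<And>y. y \<in> B \<Longrightarrow> y \<noteq> z \<Longrightarrow> y < a"
  shows "split_sum n A $ 2 = e ^ (card B * (1 + card S)) * (1 + e) * occ_coef e 0 (card S) * occ_coef e 0 (card B)"
proof -
  have fin: "finite A" "finite B"
    using A B by auto
  have disj: "A \<inter> B = {}"
    using B by auto
  have B': "B = insert z (B - {z})"
    using z by auto
  have ge: "y \<le> x" if "x \<in> A" "y \<in> B" "y \<noteq> z" for x y
    using that A z by (metis insert_iff less_imp_le less_trans)
  have "ascents A B = {(a, z), (b, z)}"
  proof
    show "ascents A B \<subseteq> {(a, z), (b, z)}"
    proof
      fix p assume "p \<in> ascents A B"
      then obtain x y where p: "p = (x, y)" "x \<in> A" "y \<in> B" "x < y"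
        by (auto simp: ascents_def)
      then have y: "y = z"
        using ge leD by blast
      then have "x \<notin> S"
        using p z(4) less_asym by blast
      then show "p \<in> {(a, z), (b, z)}"
        using p y A(1) by blast
    qed
  qed (use A z in \<open>auto simp: ascents_def\<close>)
  then have asc: "card (ascents A B) = 2"
    using z by (simp add: card_insert_if)
  have cA: "card A = 2 + card S"
  proof -
    have "b \<notin> S" "a \<notin> insert b S"
      using z by force+
    then show ?thesis
      using A B by simp
  qed
  have e: "e ^ (card B * (1 + card A) + 2) = e ^ (card B * (1 + card S))"
    unfolding cA by (rule power_cong_parity) auto
  have *: "weight e (ys @ n # zs) = (fps_const (e ^ (card B * (1 + card S))) * X ^ 2)
      * (X ^ straddle_count z ys * weight e ys) * weight e zs"
    if "ys \<in> permutations_of_set A" "zs \<in> permutations_of_set B" for ys zs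
  proof -
    have ys: "set ys = A" and zs: "set zs = B" "distinct zs"
      using that by (auto simp: permutations_of_set_def)
    \<comment> \<open>Only \<open>z\<close> can exceed an element of \<open>A\<close>, so the
      filtered list has at most one entry.\<close>
    have "inv_count (filter (\<lambda>y. x < y) zs) = 0" if "x \<in> A" for x
    proof -
      have "set (filter (\<lambda>y. x < y) zs) \<subseteq> {z}"
      proof
        fix y assume "y \<in> set (filter (\<lambda>y. x < y) zs)"
        then have "y \<in> B" "x < y"
          using zs by auto
        then show "y \<in> {z}"
          using ge[OF that] leD by blast
      qed
      from card_mono[OF _ this] have "card (set (filter (\<lambda>y. x < y) zs)) \<le> 1"
        by simp
      then have "length (filter (\<lambda>y. x < y) zs) \<le> 1"
        using zs by (simp only: distinct_card distinct_filter)
      then show ?thesis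
        by (simp add: inv_count_eq_0_iff sorted01)
    qed
    then have inv: "(\<Sum>x\<in>A. inv_count (filter (\<lambda>y. x < y) zs)) = 0"
      by simp
    have "straddle_count y ys = 0" if "y \<in> B - {z}" for y
      using that ge ys by (intro straddle_count_eq_0) auto
    then have str: "(\<Sum>y\<in>B. straddle_count y ys) = straddle_count z ys"
      using fin by (subst B', subst sum.insert) auto
    have "x < n" if "x \<in> A \<union> B" for x
      using that A B by auto
    note weight_split[OF that this disj]
    then show ?thesis
      unfolding asc inv str e by (simp only: power_add ac_simps add_0_right power_0 mult_1_left mult_1_right)
  qed
  have "split_sum n A = (fps_const (e ^ (card B * (1 + card S))) * X ^ 2)
    * (\<Sum>ys\<in>permutations_of_set A. X ^ straddle_count z ys * weight e ys) * weight_sum e B"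
    unfolding split_sum_def B(1)[symmetric] weight_sum_def sum_sum_mult[symmetric]
    by (intro sum.cong refl *)
  then show ?thesis
    using fin insert_two_min_sum_nth_0[OF B(2) z(2,3,4)]
    by (simp add: mult.assoc fps_X_power_mult_nth weight_sum_nth A(1))
qed

text \<open>A permutation avoiding 132 has its maximum \<open>c\<close> before its second largest value \<open>b\<close> only if \<open>c\<close> comes first,
  since any earlier \<open>x\<close> would give the occurrence \<open>x c b\<close>; these are the permutations subtracted.\<close>

lemma sum_second_max_first_nth_0:
  assumes "finite T" "{y \<in> T. a < y} = {b}" "\<And>x. x \<in> T \<Longrightarrow> x < c"
  shows "(\<Sum>zs\<in>permutations_of_set (insert c T). X ^ inv_count (filter (\<lambda>y. a < y) zs) * weight e zs) $ 0
    = occ_coef e 0 (Suc (card T)) - e ^ card T * occ_coef e 0 (card T)"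
proof -
  have b: "b \<in> T" "a < b" and c: "c \<notin> T"
    using assms(2) assms(3)[of c] by auto
  then have "b < c" "a < c"
    using assms(3)[of b] by auto
  note b = b this
  have sub: "x = b" if "x \<in> T" "a < x" for x
    using that assms(2) by blast
  \<comment> \<open>The difference survives only when \<open>c\<close> comes first. Otherwise both
    terms vanish because \<open>zs\<close> has an occurrence, or they agree because the values above
    \<open>a\<close> are sorted.\<close>
  have key: "weight e zs $ 0 - (X ^ inv_count (filter (\<lambda>y. a < y) zs) * weight e zs) $ 0
      = (if k = 0 then e ^ card T * weight e ws $ 0 else 0)"
    if "ws \<in> permutations_of_set T" "k \<le> card T" and zs: "zs = take k ws @ c # drop k ws" for ws k zs
  proof -
    have ws: "set ws = T" "length ws = card T" "distinct ws"
      using that by (auto simp: permutations_of_set_def distinct_card)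
    show ?thesis
    proof (cases "k = 0")
      case True
      have "filter (\<lambda>y. c < y) ws = []" "filter (\<lambda>y. y < c) ws = ws"
        using assms ws by (auto simp: filter_empty_conv filter_id_conv dest: less_asym)
      then have "weight e zs = fps_const (e ^ card T) * weight e ws"
        using True zs ws by (simp add: weight_def power_add fps_const_mult[symmetric] mult.assoc del: fps_const_mult)
      moreover have "b \<in> set (filter (\<lambda>y. y < c) (filter (\<lambda>y. a < y) ws))"
        using b ws by simp
      from length_pos_if_in_set[OF this] have "inv_count (filter (\<lambda>y. a < y) zs) > 0"
        using True zs b by (simp del: filter_filter length_greater_0_conv)
      ultimately show ?thesis
        using True by (simp add: fps_X_power_mult_nth)
    next
      case False
      show ?thesis
      proof (cases "b \<in> set (drop k ws)")
        case True
        have "take k ws \<noteq> []"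
          using False ws b by auto
        then obtain x xs where x: "take k ws = x # xs"
          by (meson neq_Nil_conv)
        then have "x \<in> set (take k ws)"
          by simp
        then have "x \<in> T"
          using ws in_set_takeD by fastforce
        have "set (take k ws) \<inter> set (drop k ws) = {}"
          using ws(3) by (metis append_take_drop_id distinct_append)
        then have "x \<noteq> b"
          using True x by auto
        then have "x \<le> a"
          using \<open>x \<in> T\<close> sub not_le by blast
        then have "x < b" "x < c"
          using b by auto
        then have "b \<in> set (filter (\<lambda>y. y < c) (filter (\<lambda>y. x < y) (drop k ws)))"
          using True b by simp
        from length_pos_if_in_set[OF this] have "inv_count (filter (\<lambda>y. x < y) (xs @ c # drop k ws)) > 0"
          using \<open>x < c\<close> by (simp add: inv_count_append del: filter_filter length_greater_0_conv)
        then have "occ_count zs > 0"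
          unfolding zs x by simp
        then show ?thesis
          using False by (simp add: weight_def fps_X_power_mult_nth mult.left_commute[of _ "X ^ occ_count _"]
              fps_X_power_mult_right_nth)
      next
        case f: False
        have drop: "filter (\<lambda>y. a < y) (drop k ws) = []"
          using f sub ws by (auto simp: filter_empty_conv dest: in_set_dropD)
        have "sorted us" if "set us \<subseteq> {b}" for us
          using that by (induction us) auto
        moreover have le: "set (filter (\<lambda>y. a < y) (take k ws)) \<subseteq> {b}"
          using sub ws by (auto dest: in_set_takeD)
        ultimately have "sorted (filter (\<lambda>y. a < y) (take k ws))"
          by blast
        moreover have "filter (\<lambda>y. a < y) zs = filter (\<lambda>y. a < y) (take k ws) @ [c]"
          using drop b by (simp add: zs)
        moreover have "x \<le> c" if "x \<in> set (filter (\<lambda>y. a < y) (take k ws))" for x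
          using le that b by (metis less_imp_le singletonD subsetD)
        ultimately have "sorted (filter (\<lambda>y. a < y) zs)"
          by (simp only: sorted_append) simp
        then show ?thesis
          using False by (simp add: inv_count_eq_0_iff[THEN iffD2])
      qed
    qed
  qed
  have w: "weight_sum e (insert c T) $ 0 = occ_coef e 0 (Suc (card T))"
    using weight_sum_nth[of "insert c T" e 0] assms c by simp
  have "occ_coef e 0 (Suc (card T)) -
      (\<Sum>zs\<in>permutations_of_set (insert c T). X ^ inv_count (filter (\<lambda>y. a < y) zs) * weight e zs) $ 0
    = (\<Sum>zs\<in>permutations_of_set (insert c T).
        weight e zs $ 0 - (X ^ inv_count (filter (\<lambda>y. a < y) zs) * weight e zs) $ 0)"
    unfolding w[symmetric] by (simp only: weight_sum_def fps_sum_nth sum_subtractf)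
  also have "\<dots> = (\<Sum>ws\<in>permutations_of_set T. \<Sum>k\<le>card T. if k = 0 then e ^ card T * weight e ws $ 0 else 0)"
    by (subst sum_permutations_insert[OF assms(1) c], intro sum.cong refl key) auto
  also have "\<dots> = e ^ card T * occ_coef e 0 (card T)"
    using assms by (simp add: weight_sum_nth[symmetric] weight_sum_def fps_sum_nth sum_distrib_left)
  finally show ?thesis
    by simp
qed

end

subsection \<open>Recurrences\<close>

lemma fps_mult_X_mult_nth:
  fixes f g :: "rat fps"
  shows "(fps_const c * (X * (f * g))) $ 1 = c * (f $ 0 * g $ 0)"
    and "(fps_const c * (X * (f * g))) $ 2 = c * (f $ 0 * g $ 1 + f $ 1 * g $ 0)"
  by (simp_all add: fps_mult_nth_0 fps_mult_nth numeral_2_eq_2)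

section \<open>Generating functions by length\<close>

context sign_weight
begin

text \<open>The Cauchy product with the sign of a split without ascents: \<open>i\<close> entries
  precede the maximum, and each of the \<open>n - i\<close> smaller ones after it is inverted with
  the maximum and the whole left part.\<close>

definition twist :: "rat fps \<Rightarrow> rat fps \<Rightarrow> rat fps" where
  "twist f g = Abs_fps (\<lambda>n. \<Sum>i\<le>n. e ^ ((n - i) * (1 + i)) * f $ i * g $ (n - i))"

text \<open>The substitution of \<open>e * x\<close> for the length variable
  \<open>x\<close>.\<close>

definition flip :: "rat fps \<Rightarrow> rat fps" where
  "flip f = Abs_fps (\<lambda>n. e ^ n * f $ n)"

definition occ_series :: "nat \<Rightarrow> rat fps" where
  "occ_series r = Abs_fps (occ_coef e r)"

lemma no_ascent_part:
  "(\<Sum>A | A \<subseteq> {..<n} \<and> card (ascents A ({..<n} - A)) = 0. split_sum n A $ r)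
    = (\<Sum>s\<le>r. twist (occ_series s) (occ_series (r - s)) $ n)"
proof -
  have "inj_on (\<lambda>j. {j..<n}) {..n}"
  proof (rule inj_onI)
    fix i j assume "i \<in> {..n}" "j \<in> {..n}" "{i..<n} = {j..<n}"
    then have "i \<le> n" "j \<le> n" "n - i = n - j"
      by (auto dest: arg_cong[where f = card])
    then show "i = j"
      by simp
  qed
  then have "(\<Sum>A | A \<subseteq> {..<n} \<and> card (ascents A ({..<n} - A)) = 0. split_sum n A $ r)
      = (\<Sum>j\<le>n. split_sum n {j..<n} $ r)"
    unfolding no_ascent_sets by (subst sum.reindex) simp_all
  also have "\<dots> = (\<Sum>j\<le>n. \<Sum>s\<le>r. e ^ (j * (1 + (n - j))) * occ_coef e s (n - j) * occ_coef e (r - s) j)"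
  proof (intro sum.cong refl)
    fix j assume "j \<in> {..n}"
    then have "split_sum n {j..<n} $ r = e ^ (j * (1 + (n - j))) * (weight_sum e {j..<n} * weight_sum e {..<j}) $ r"
      by (simp add: split_sum_no_ascent mult.assoc)
    also have "\<dots> = (\<Sum>s\<le>r. e ^ (j * (1 + (n - j))) * occ_coef e s (n - j) * occ_coef e (r - s) j)"
      unfolding fps_mult_nth sum_distrib_left atLeast0AtMost
      by (simp add: weight_sum_nth mult.assoc)
    finally show "split_sum n {j..<n} $ r
        = (\<Sum>s\<le>r. e ^ (j * (1 + (n - j))) * occ_coef e s (n - j) * occ_coef e (r - s) j)" .
  qed
  also have "\<dots> = (\<Sum>i\<le>n. \<Sum>s\<le>r. e ^ ((n - i) * (1 + i)) * occ_coef e s i * occ_coef e (r - s) (n - i))"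
    by (rule sum.reindex_bij_witness[of _ "\<lambda>i. n - i" "\<lambda>i. n - i"]) auto
  also have "\<dots> = (\<Sum>s\<le>r. twist (occ_series s) (occ_series (r - s)) $ n)"
    by (subst sum.swap) (simp add: twist_def occ_series_def)
  finally show ?thesis .
qed

text \<open>The ascent is \<open>(a, a + 1)\<close>. A second occurrence comes from the right part,
  from the rest of the left part, or from \<open>a\<close> in the last place but one of the left
  part; the last option needs \<open>k > 0\<close>.\<close>

lemma split_sum_one_ascent:
  assumes "a < n - 1"
  defines "A \<equiv> insert a {a + 2..<n}" and "k \<equiv> n - a - 2"
  shows "split_sum n A $ 1 = e * (e ^ (k * (2 + a)) * occ_coef e 0 (a + 1) * occ_coef e 0 k)"
    and "split_sum n A $ 2 =
      e * (e ^ (k * (2 + a)) * occ_coef e 1 (a + 1) * occ_coef e 0 k)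
      + e * (e ^ (k * (2 + a)) * occ_coef e 0 (a + 1) * occ_coef e 1 k)
      + e ^ (k * (2 + a)) * occ_coef e 0 (a + 1) * (if k = 0 then 0 else occ_coef e 0 k)"
proof -
  let ?S = "{a + 2..<n}" and ?B = "{..<n} - A"
  let ?V = "\<Sum>ws\<in>permutations_of_set ?S. \<Sum>k\<le>card ?S. X ^ (1 * (card ?S - k)) * weight e (take k ws @ a # drop k ws)"
  have k: "card ?S = k" "?S = {} \<longleftrightarrow> k = 0"
    using assms by auto
  have B: "?B = insert (a + 1) {..<a}"
    using assms by auto
  then have cB: "card ?B = a + 1"
    by simp
  have up: "{z \<in> ?B. a < z} = {a + 1}"
    unfolding B by auto
  then have card_up: "card {z \<in> ?B. a < z} = 1"
    by simp
  have Q: "(\<Sum>zs\<in>permutations_of_set ?B. X ^ inv_count (filter (\<lambda>y. a < y) zs) * weight e zs) = weight_sum e ?B"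
    unfolding weight_sum_def
  proof (intro sum.cong refl)
    fix zs assume "zs \<in> permutations_of_set ?B"
    then have zs: "set zs = ?B" "distinct zs"
      by (auto simp: permutations_of_set_def)
    then have "length (filter (\<lambda>y. a < y) zs) = card {a + 1}"
      using up by (simp only: length_filter_distinct)
    then have "inv_count (filter (\<lambda>y. a < y) zs) = 0"
      unfolding inv_count_eq_0_iff by (intro sorted01) simp
    then show "X ^ inv_count (filter (\<lambda>y. a < y) zs) * weight e zs = weight e zs"
      by simp
  qed
  have "split_sum n A = fps_const (e ^ (card ?B * (2 + card ?S) + 1)) * X ^ 1 * ?V
    * (\<Sum>zs\<in>permutations_of_set ?B. X ^ inv_count (filter (\<lambda>y. a < y) zs) * weight e zs)"
    by (rule split_sum_one_low[OF _ _ _ _ _ _ card_up]) (use assms in \<open>auto simp: A_def\<close>)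
  then have split: "split_sum n A = fps_const (e ^ ((a + 1) * (2 + k) + 1)) * (X * (?V * weight_sum e ?B))"
    unfolding Q cB k by (simp only: mult.assoc power_one_right)
  have V0: "?V $ 0 = e ^ k * occ_coef e 0 k"
    using insert_min_sum_nth_0[of ?S a 1] unfolding k(1) by simp
  have V1: "?V $ 1 = e ^ k * occ_coef e 1 k + (if k = 0 then 0 else e ^ (k - 1) * occ_coef e 0 k)"
    using insert_min_sum_nth_1[of ?S a] unfolding k by simp
  have W: "weight_sum e ?B $ r = occ_coef e r (a + 1)" for r
    using weight_sum_nth[of ?B e r] cB by simp
  have e1: "e ^ ((a + 1) * (2 + k) + 1) * e ^ k = e * e ^ (k * (2 + a))"
    unfolding power_add[symmetric] power_Suc[symmetric] by (rule power_cong_parity) auto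
  have e2: "e ^ ((a + 1) * (2 + k) + 1) * e ^ (k - 1) = e ^ (k * (2 + a))" if k0: "k \<noteq> 0"
  proof -
    obtain l where l: "k = Suc l"
      using k0 by (cases k) auto
    show ?thesis
      unfolding power_add[symmetric] l by (rule power_cong_parity) auto
  qed
  have "split_sum n A $ 1 = (e ^ ((a + 1) * (2 + k) + 1) * e ^ k) * occ_coef e 0 k * occ_coef e 0 (a + 1)"
    unfolding split fps_mult_X_mult_nth V0 W by (simp only: ac_simps)
  then show "split_sum n A $ 1 = e * (e ^ (k * (2 + a)) * occ_coef e 0 (a + 1) * occ_coef e 0 k)"
    unfolding e1 by simp
  have "split_sum n A $ 2 = e ^ ((a + 1) * (2 + k) + 1) * (?V $ 0 * weight_sum e ?B $ 1 + ?V $ 1 * weight_sum e ?B $ 0)"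
    unfolding split fps_mult_X_mult_nth ..
  also have "\<dots> = (e ^ ((a + 1) * (2 + k) + 1) * e ^ k) * (occ_coef e 0 k * occ_coef e 1 (a + 1) + occ_coef e 1 k * occ_coef e 0 (a + 1))
      + (if k = 0 then 0 else (e ^ ((a + 1) * (2 + k) + 1) * e ^ (k - 1)) * occ_coef e 0 k * occ_coef e 0 (a + 1))"
    unfolding V0 V1 W by (simp add: algebra_simps del: One_nat_def)
  finally show "split_sum n A $ 2 =
      e * (e ^ (k * (2 + a)) * occ_coef e 1 (a + 1) * occ_coef e 0 k)
      + e * (e ^ (k * (2 + a)) * occ_coef e 0 (a + 1) * occ_coef e 1 k)
      + e ^ (k * (2 + a)) * occ_coef e 0 (a + 1) * (if k = 0 then 0 else occ_coef e 0 k)"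
    using e2 unfolding e1 by (cases "k = 0") (simp_all add: algebra_simps)
qed

text \<open>The ascents \<open>(a, a + 1)\<close> and \<open>(a, a + 2)\<close> exhaust degree 2. On
  the left \<open>a\<close> must come last; on the right \<open>a + 1\<close> must precede
  \<open>a + 2\<close>, which gives the difference.\<close>

lemma split_sum_two_ascents_1:
  assumes "a < n - 2"
  defines "A \<equiv> insert a {a + 3..<n}" and "k \<equiv> n - a - 3"
  shows "split_sum n A $ 2 =
    e ^ (k * (3 + a)) * (occ_coef e 0 (a + 2) - e ^ (a + 1) * occ_coef e 0 (a + 1)) * occ_coef e 0 k"
proof -
  let ?S = "{a + 3..<n}" and ?B = "{..<n} - A"
  let ?V = "\<Sum>ws\<in>permutations_of_set ?S. \<Sum>k\<le>card ?S. X ^ (2 * (card ?S - k)) * weight e (take k ws @ a # drop k ws)"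
  let ?Q = "\<Sum>zs\<in>permutations_of_set ?B. X ^ inv_count (filter (\<lambda>y. a < y) zs) * weight e zs"
  have k: "card ?S = k"
    using assms by auto
  have B: "?B = insert (a + 2) (insert (a + 1) {..<a})"
    using assms by auto
  then have cB: "card ?B = a + 2"
    by simp
  have "{z \<in> ?B. a < z} = {a + 1, a + 2}"
    unfolding B by auto
  then have up: "card {z \<in> ?B. a < z} = 2"
    by simp
  have "split_sum n A = fps_const (e ^ (card ?B * (2 + card ?S) + 2)) * X ^ 2 * ?V * ?Q"
    by (rule split_sum_one_low[OF _ _ _ _ _ _ up]) (use assms in \<open>auto simp: A_def\<close>)
  then have split: "split_sum n A = fps_const (e ^ ((a + 2) * (2 + k) + 2)) * (X ^ 2 * (?V * ?Q))"
    unfolding cB k by (simp only: mult.assoc)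
  have V0: "?V $ 0 = e ^ k * occ_coef e 0 k"
    using insert_min_sum_nth_0[of ?S a 2] unfolding k by simp
  let ?T = "insert (a + 1) {..<a}"
  have low: "{y \<in> ?T. a < y} = {a + 1}"
    by auto
  have "?Q $ 0 = occ_coef e 0 (Suc (card ?T)) - e ^ card ?T * occ_coef e 0 (card ?T)"
    unfolding B by (rule sum_second_max_first_nth_0[OF _ low]) auto
  then have Q0: "?Q $ 0 = occ_coef e 0 (a + 2) - e ^ (a + 1) * occ_coef e 0 (a + 1)"
    by simp
  have e: "e ^ ((a + 2) * (2 + k) + 2) * e ^ k = e ^ (k * (3 + a))"
    unfolding power_add[symmetric] by (rule power_cong_parity) auto
  have "split_sum n A $ 2 = e ^ ((a + 2) * (2 + k) + 2) * (?V $ 0 * ?Q $ 0)"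
    unfolding split by (simp only: fps_mult_left_const_nth fps_X_power_mult_nth fps_mult_nth_0) simp
  also have "\<dots> = (e ^ ((a + 2) * (2 + k) + 2) * e ^ k)
      * (occ_coef e 0 (a + 2) - e ^ (a + 1) * occ_coef e 0 (a + 1)) * occ_coef e 0 k"
    unfolding V0 Q0 by (simp only: ac_simps)
  finally show ?thesis
    unfolding e .
qed

text \<open>The ascents are \<open>(a, a + 2)\<close> and \<open>(a + 1, a + 2)\<close>; the factor
  \<open>1 + e\<close> records the two orders of \<open>a\<close> and \<open>a + 1\<close> at the
  end of the left part.\<close>

lemma split_sum_two_ascents_2:
  assumes "a < n - 2"
  defines "A \<equiv> insert a (insert (a + 1) {a + 3..<n})" and "k \<equiv> n - a - 3"
  shows "split_sum n A $ 2 = (1 + e) * (e ^ ((a + 1) * (1 + k)) * occ_coef e 0 k * occ_coef e 0 (a + 1))"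
proof -
  let ?S = "{a + 3..<n}" and ?B = "{..<n} - A"
  have k: "card ?S = k"
    using assms by auto
  have B: "?B = insert (a + 2) {..<a}"
    using assms by auto
  then have cB: "card ?B = a + 1"
    by simp
  have "split_sum n A $ 2 = e ^ (card ?B * (1 + card ?S)) * (1 + e) * occ_coef e 0 (card ?S) * occ_coef e 0 (card ?B)"
  proof (rule split_sum_two_low[where a = a and b = "a + 1" and z = "a + 2"])
    show "a + 2 \<in> ?B" and "\<And>y. y \<in> ?B \<Longrightarrow> y \<noteq> a + 2 \<Longrightarrow> y < a"
      unfolding B by auto
  qed (use assms in \<open>auto simp: A_def\<close>)
  then show ?thesis
    unfolding k cB by (simp only: ac_simps)
qed

lemma twist_nth_shift:
  assumes "f $ 0 = 0"
  shows "twist f g $ n = (\<Sum>a<n. e ^ ((n - Suc a) * (2 + a)) * f $ Suc a * g $ (n - Suc a))"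
proof -
  have "twist f g $ n = (\<Sum>i<Suc n. e ^ ((n - i) * (1 + i)) * f $ i * g $ (n - i))"
    by (simp add: twist_def lessThan_Suc_atMost)
  then show ?thesis
    by (subst (asm) sum.lessThan_Suc_shift) (simp add: assms)
qed

lemma occ_coef_0_0: "occ_coef e 0 0 = 1"
  by (simp add: occ_coef_def weight_sum_def weight_def)

lemma occ_coef_Suc_0: "occ_coef e (Suc r) 0 = 0"
  by (simp add: occ_coef_def weight_sum_def weight_def)

lemma occ_series_nth: "occ_series r $ n = occ_coef e r n"
  by (simp add: occ_series_def)

lemma occ_series_0_tail_nth: "(occ_series 0 - 1) $ n = (if n = 0 then 0 else occ_coef e 0 n)"
  by (simp add: occ_series_nth occ_coef_0_0)

lemma one_ascent_part:
  "(\<Sum>A | A \<subseteq> {..<Suc n} \<and> card (ascents A ({..<Suc n} - A)) = 1. split_sum (Suc n) A $ r)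
    = (\<Sum>a<n. split_sum (Suc n) (insert a {a + 2..<Suc n}) $ r)"
  unfolding one_ascent_sets by (subst sum.reindex[OF inj_on_low_set]) simp_all

text \<open>The roles are swapped: the first argument of \<open>twist\<close> stands for the right
  part, of size \<open>a + 1\<close> and never empty, hence the \<open>- 1\<close>; the second
  stands for the left part without \<open>a\<close>.\<close>

lemma one_ascent_part_1:
  "(\<Sum>A | A \<subseteq> {..<Suc n} \<and> card (ascents A ({..<Suc n} - A)) = 1. split_sum (Suc n) A $ 1)
    = e * twist (occ_series 0 - 1) (occ_series 0) $ n"
proof -
  have "split_sum (Suc n) (insert a {a + 2..<Suc n}) $ 1
      = e * (e ^ ((n - Suc a) * (2 + a)) * (occ_series 0 - 1) $ Suc a * occ_series 0 $ (n - Suc a))"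
    if "a < n" for a
    using split_sum_one_ascent(1)[of a "Suc n"] that
    by (simp add: occ_series_nth numeral_2_eq_2)
  then show ?thesis
    unfolding one_ascent_part
    by (subst twist_nth_shift) (simp_all add: occ_series_nth occ_coef_0_0 sum_distrib_left)
qed

text \<open>The last term belongs to \<open>a\<close> in the last place but one of the left part;
  the rest of that part is then nonempty, hence the second \<open>- 1\<close>.\<close>

lemma one_ascent_part_2:
  "(\<Sum>A | A \<subseteq> {..<Suc n} \<and> card (ascents A ({..<Suc n} - A)) = 1. split_sum (Suc n) A $ 2)
    = e * twist (occ_series 1) (occ_series 0) $ n + e * twist (occ_series 0 - 1) (occ_series 1) $ n
      + twist (occ_series 0 - 1) (occ_series 0 - 1) $ n"
proof -
  have "split_sum (Suc n) (insert a {a + 2..<Suc n}) $ 2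
      = e * (e ^ ((n - Suc a) * (2 + a)) * occ_series 1 $ Suc a * occ_series 0 $ (n - Suc a))
        + e * (e ^ ((n - Suc a) * (2 + a)) * (occ_series 0 - 1) $ Suc a * occ_series 1 $ (n - Suc a))
        + e ^ ((n - Suc a) * (2 + a)) * (occ_series 0 - 1) $ Suc a * (occ_series 0 - 1) $ (n - Suc a)"
    if "a < n" for a
    using split_sum_one_ascent(2)[of a "Suc n"] that
    unfolding occ_series_0_tail_nth occ_series_nth by (simp add: numeral_2_eq_2)
  then show ?thesis
    unfolding one_ascent_part
    by (subst (1 2 3) twist_nth_shift)
      (simp_all add: occ_series_nth occ_coef_0_0 occ_coef_Suc_0 sum_distrib_left sum.distrib)
qed

text \<open>From degree 2 on, the coefficients are the signed counts of permutations avoiding 132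
  whose second largest value precedes the largest; degrees 0 and 1 vanish.\<close>

definition second_max_series :: "rat fps" where
  "second_max_series = occ_series 0 - 1 - X * flip (occ_series 0)"

lemma occ_series_0_rec: "occ_series 0 = 1 + X * twist (occ_series 0) (occ_series 0)"
proof (rule fps_ext)
  fix n show "occ_series 0 $ n = (1 + X * twist (occ_series 0) (occ_series 0)) $ n"
  proof (cases n)
    case 0
    then show ?thesis
      by (simp add: occ_series_nth occ_coef_0_0)
  next
    case (Suc m)
    then show ?thesis
      using weight_sum_Suc_nth[of m 0] no_ascent_part[of m 0]
      by (simp add: occ_series_nth occ_coef_def)
  qed
qed

lemma occ_coef_0_1: "occ_coef e 0 1 = 1"
  using arg_cong[OF occ_series_0_rec, of "\<lambda>f. f $ 1"] by (simp add: occ_series_nth twist_def occ_coef_0_0)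

lemma second_max_series_nth_0: "second_max_series $ 0 = 0"
  by (simp add: second_max_series_def occ_series_nth occ_coef_0_0)

lemma second_max_series_nth_Suc:
  "second_max_series $ Suc n = occ_coef e 0 (Suc n) - e ^ n * occ_coef e 0 n"
  by (simp add: second_max_series_def occ_series_nth flip_def)

lemma two_ascents_part:
  "(\<Sum>A | A \<subseteq> {..<n} \<and> card (ascents A ({..<n} - A)) = 2. split_sum n A $ 2)
    = (\<Sum>a<n - 2. split_sum n (insert a {a + 3..<n}) $ 2)
      + (\<Sum>a<n - 2. split_sum n (insert a (insert (a + 1) {a + 3..<n})) $ 2)"
proof -
  let ?f = "\<lambda>a. insert a {a + 3..<n}" and ?g = "\<lambda>a. insert a (insert (a + 1) {a + 3..<n})"
  have "?f a \<noteq> ?g b" for a b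
  proof
    assume eq: "?f a = ?g b"
    then have "a \<in> ?g b" "b \<in> ?f a"
      by blast+
    then have "a = b"
      by auto
    then have "a + 1 \<in> ?f a"
      using eq by blast
    then show False
      by simp
  qed
  then have disj: "?f ` I \<inter> ?g ` I = {}" for I
    by blast
  show ?thesis
    unfolding two_ascents_sets
    by (subst sum.union_disjoint, simp, simp, rule disj,
        subst sum.reindex[OF inj_on_low_set], simp, subst sum.reindex[OF inj_on_two_low_set]) simp
qed

lemma two_ascents_part_1:
  "(\<Sum>a<Suc n - 2. split_sum (Suc n) (insert a {a + 3..<Suc n}) $ 2)
    = twist second_max_series (occ_series 0) $ n"
proof (cases n)
  case 0
  then show ?thesis
    by (simp add: twist_def second_max_series_nth_0)
next
  case (Suc m)
  have "split_sum (Suc n) (insert a {a + 3..<Suc n}) $ 2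
      = e ^ ((n - Suc (Suc a)) * (2 + Suc a)) * second_max_series $ Suc (Suc a) * occ_series 0 $ (n - Suc (Suc a))"
    if "a < m" for a
    using split_sum_two_ascents_1[of a "Suc n"] that Suc
    by (simp add: occ_series_nth second_max_series_nth_Suc numeral_3_eq_3 numeral_2_eq_2)
  \<comment> \<open>The vanishing linear coefficient lets the sum start at index 2, the least size
    of a right part containing \<open>a + 1\<close> and \<open>a + 2\<close>.\<close>
  moreover have "second_max_series $ Suc 0 = 0"
    using occ_coef_0_1 by (simp add: second_max_series_nth_Suc occ_coef_0_0)
  ultimately show ?thesis
    using Suc by (subst twist_nth_shift[OF second_max_series_nth_0]) (simp add: sum.lessThan_Suc_shift del: sum.lessThan_Suc)
qed

text \<open>Here the first argument of \<open>twist\<close> is the left part without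
  \<open>a\<close> and \<open>a + 1\<close>. Taking out two values instead of one accounts for the
  factor \<open>X\<close>.\<close>

lemma two_ascents_part_2:
  "(\<Sum>a<Suc n - 2. split_sum (Suc n) (insert a (insert (a + 1) {a + 3..<Suc n})) $ 2)
    = (1 + e) * (X * twist (occ_series 0) (occ_series 0 - 1)) $ n"
proof (cases n)
  case 0
  then show ?thesis
    by simp
next
  case (Suc m)
  have "(\<Sum>a<Suc n - 2. split_sum (Suc n) (insert a (insert (a + 1) {a + 3..<Suc n})) $ 2)
    = (\<Sum>a<m. (1 + e) * (e ^ (Suc a * (1 + (m - Suc a))) * occ_series 0 $ (m - Suc a) * (occ_series 0 - 1) $ Suc a))"
  proof (intro sum.cong)
    fix a assume "a \<in> {..<m}"
    then show "split_sum (Suc n) (insert a (insert (a + 1) {a + 3..<Suc n})) $ 2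
      = (1 + e) * (e ^ (Suc a * (1 + (m - Suc a))) * occ_series 0 $ (m - Suc a) * (occ_series 0 - 1) $ Suc a)"
      using split_sum_two_ascents_2[of a "Suc n"] Suc
      unfolding occ_series_0_tail_nth occ_series_nth by (simp add: numeral_3_eq_3)
  qed (simp add: Suc)
  also have "\<dots> = (\<Sum>i<m. (1 + e) * (e ^ ((m - i) * (1 + i)) * occ_series 0 $ i * (occ_series 0 - 1) $ (m - i)))"
    by (rule sum.reindex_bij_witness[of _ "\<lambda>i. m - Suc i" "\<lambda>i. m - Suc i"]) (auto simp: Suc_diff_Suc)
  also have "\<dots> = (1 + e) * twist (occ_series 0) (occ_series 0 - 1) $ m"
    by (simp add: twist_def sum_distrib_left occ_series_nth occ_coef_0_0 flip: lessThan_Suc_atMost)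
  finally show ?thesis
    using Suc by simp
qed

text \<open>One \<open>X\<close> stands for the maximum; the other in \<open>X ^ 2\<close> stands
  for the value \<open>a\<close> taken out of the left part when the single occurrence is an
  ascent.\<close>

lemma occ_series_1_rec:
  "occ_series 1 = X * (twist (occ_series 0) (occ_series 1) + twist (occ_series 1) (occ_series 0))
     + fps_const e * X ^ 2 * twist (occ_series 0 - 1) (occ_series 0)"
proof (rule fps_ext)
  fix n
  \<comment> \<open>Bracketed so that each factor \<open>X\<close> can be peeled off as an index
    shift.\<close>
  let ?r = "X * (twist (occ_series 0) (occ_series 1) + twist (occ_series 1) (occ_series 0))
     + X * (fps_const e * (X * twist (occ_series 0 - 1) (occ_series 0)))"
  have "occ_series 1 $ n = ?r $ n"
  proof (cases n)
    case 0
    then show ?thesis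
      by (simp add: occ_series_nth occ_coef_Suc_0)
  next
    case (Suc m)
    have "occ_coef e 1 (Suc m) = (twist (occ_series 0) (occ_series 1) + twist (occ_series 1) (occ_series 0)) $ m
      + (\<Sum>A | A \<subseteq> {..<m} \<and> card (ascents A ({..<m} - A)) = 1. split_sum m A $ 1)"
      unfolding occ_coef_def weight_sum_Suc_nth
      using no_ascent_part[of m 1] by simp
    moreover have "(\<Sum>A | A \<subseteq> {..<m} \<and> card (ascents A ({..<m} - A)) = 1. split_sum m A $ 1)
      = (fps_const e * (X * twist (occ_series 0 - 1) (occ_series 0))) $ m"
    proof (cases m)
      case 0
      then show ?thesis
        unfolding one_ascent_sets by simp
    next
      case (Suc l)
      then show ?thesis
        using one_ascent_part_1[of l] by simp
    qed
    ultimately show ?thesis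
      using Suc by (simp add: occ_series_nth)
  qed
  then show "occ_series 1 $ n = (X * (twist (occ_series 0) (occ_series 1) + twist (occ_series 1) (occ_series 0))
     + fps_const e * X ^ 2 * twist (occ_series 0 - 1) (occ_series 0)) $ n"
    by (simp only: power2_eq_square ac_simps)
qed

text \<open>After the splits without ascents, the terms under \<open>X ^ 2\<close> come from one
  ascent, from two ascents with common lower member, and from two with common upper member.\<close>

lemma occ_series_2_rec:
  "occ_series 2 = X * (twist (occ_series 0) (occ_series 2) + twist (occ_series 1) (occ_series 1) + twist (occ_series 2) (occ_series 0))
     + X ^ 2 * (fps_const e * (twist (occ_series 1) (occ_series 0) + twist (occ_series 0 - 1) (occ_series 1))
       + twist (occ_series 0 - 1) (occ_series 0 - 1) + twist second_max_series (occ_series 0)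
       + fps_const (1 + e) * (X * twist (occ_series 0) (occ_series 0 - 1)))"
    (is "_ = X * ?d0 + X ^ 2 * ?d12")
proof (rule fps_ext)
  fix n
  have "occ_series 2 $ n = (X * (?d0 + X * ?d12)) $ n"
  proof (cases n)
    case 0
    then show ?thesis
      using occ_coef_Suc_0[of 1] by (simp add: occ_series_nth numeral_2_eq_2)
  next
    case (Suc m)
    have "occ_coef e 2 (Suc m) = ?d0 $ m
      + ((\<Sum>A | A \<subseteq> {..<m} \<and> card (ascents A ({..<m} - A)) = 1. split_sum m A $ 2)
        + (\<Sum>A | A \<subseteq> {..<m} \<and> card (ascents A ({..<m} - A)) = 2. split_sum m A $ 2))"
      unfolding occ_coef_def weight_sum_Suc_nth
      using no_ascent_part[of m 2] by (simp add: numeral_2_eq_2)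
    moreover have "(\<Sum>A | A \<subseteq> {..<m} \<and> card (ascents A ({..<m} - A)) = 1. split_sum m A $ 2)
        + (\<Sum>A | A \<subseteq> {..<m} \<and> card (ascents A ({..<m} - A)) = 2. split_sum m A $ 2)
      = (X * ?d12) $ m"
    proof (cases m)
      case 0
      then show ?thesis
        unfolding one_ascent_sets two_ascents_sets by simp
    next
      case (Suc l)
      then show ?thesis
        unfolding Suc one_ascent_part_2 two_ascents_part two_ascents_part_1 two_ascents_part_2
        by (simp add: algebra_simps del: fps_const_add)
    qed
    ultimately show ?thesis
      using Suc by (simp add: occ_series_nth)
  qed
  then show "occ_series 2 $ n = (X * ?d0 + X ^ 2 * ?d12) $ n"
    by (simp only: power2_eq_square ring_distribs mult.assoc)
qed

end

subsection \<open>Solution of the recurrences\<close>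

text \<open>\<open>c\<close>, \<open>u\<close>, \<open>w\<close> are the plain series for 0, 1 and 2
  occurrences. Collecting the unknown in the equations for \<open>u\<close> and \<open>w\<close>
  leaves the factor \<open>s\<close>, a square root of \<open>1 - 4 * X\<close>.\<close>

lemma unsigned_system_solution:
  fixes X c u w :: "'a::idom"
  assumes c: "c = 1 + X * c ^ 2"
    and u: "u = X * (c * u + u * c) + X ^ 2 * ((c - 1) * c)"
    and w: "w = X * (c * w + u * u + w * c) + X ^ 2 * (u * c + (c - 1) * u
      + (c - 1) * (c - 1) + (c - 1 - X * c) * c + 2 * (X * (c * (c - 1))))"
    and s: "s = 1 - 2 * X * c"
  shows "s ^ 2 = 1 - 4 * X"
    and "2 * w * s ^ 3 = (X ^ 2 + 3 * X - 2) * s ^ 3 + (2 * X ^ 4 - 4 * X ^ 3 + 29 * X ^ 2 - 15 * X + 2)"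
proof -
  show s2: "s ^ 2 = 1 - 4 * X"
    unfolding s using c by algebra
  have us: "u * s = X ^ 2 * (c - 1) * c"
    unfolding s using u by algebra
  have ws: "w * s = X * u ^ 2 + X ^ 2 * (2 * c - 1) * u
      + X ^ 2 * ((c - 1) ^ 2 + (c - 1 - X * c) * c + 2 * X * c * (c - 1))"
    unfolding s using w by algebra
  \<comment> \<open>With the extra factor \<open>s ^ 2\<close>, \<open>u\<close> enters only through
    \<open>u * s\<close> and can be eliminated without division.\<close>
  have "w * s ^ 3 = X * (u * s) ^ 2 + X ^ 2 * (2 * c - 1) * (u * s) * s
      + X ^ 2 * ((c - 1) ^ 2 + (c - 1 - X * c) * c + 2 * X * c * (c - 1)) * s ^ 2"
    using ws by algebra
  then show "2 * w * s ^ 3 = (X ^ 2 + 3 * X - 2) * s ^ 3 + (2 * X ^ 4 - 4 * X ^ 3 + 29 * X ^ 2 - 15 * X + 2)"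
    unfolding us unfolding s using c by algebra
qed

text \<open>\<open>q\<close>, \<open>v\<close>, \<open>t\<close> are the images of \<open>p\<close>,
  \<open>u\<close>, \<open>w\<close> under \<open>x\<close> to \<open>-x\<close>, and doubling
  clears the halves in the formula for \<open>twist\<close>. Within each pair the sum is explicit in
  quantities found earlier, while the difference carries the factor \<open>s\<close>.\<close>

lemma signed_system_solution:
  fixes X p q u v w t :: "'a::idom"
  assumes two: "(2 :: 'a) \<noteq> 0"
    and p: "2 * p = 2 + X * (p * p + p * q - q * p + q * q)"
    and q: "2 * q = 2 - X * (q * q + q * p - p * q + p * p)"
    and u: "2 * u = X * ((p * u + p * v - q * u + q * v) + (u * p + u * q - v * p + v * q))
      - X ^ 2 * ((p - 1) * p + (p - 1) * q - (q - 1) * p + (q - 1) * q)"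
    and v: "2 * v = - (X * ((q * v + q * u - p * v + p * u) + (v * q + v * p - u * q + u * p)))
      - X ^ 2 * ((q - 1) * q + (q - 1) * p - (p - 1) * q + (p - 1) * p)"
    and w: "2 * w = X * ((p * w + p * t - q * w + q * t) + (u * u + u * v - v * u + v * v)
        + (w * p + w * q - t * p + t * q))
      + X ^ 2 * (- ((u * p + u * q - v * p + v * q) + ((p - 1) * u + (p - 1) * v - (q - 1) * u + (q - 1) * v))
        + ((p - 1) * (p - 1) + (p - 1) * (q - 1) - (q - 1) * (p - 1) + (q - 1) * (q - 1))
        + ((p - 1 - X * q) * p + (p - 1 - X * q) * q - (q - 1 + X * p) * p + (q - 1 + X * p) * q))"
    and t: "2 * t = - (X * ((q * t + q * w - p * t + p * w) + (v * v + v * u - u * v + u * u)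
        + (t * q + t * p - w * q + w * p)))
      + X ^ 2 * (- ((v * q + v * p - u * q + u * p) + ((q - 1) * v + (q - 1) * u - (p - 1) * v + (p - 1) * u))
        + ((q - 1) * (q - 1) + (q - 1) * (p - 1) - (p - 1) * (q - 1) + (p - 1) * (p - 1))
        + ((q - 1 + X * p) * q + (q - 1 + X * p) * p - (p - 1 - X * q) * q + (p - 1 - X * q) * p))"
    and s: "s = 1 - 2 * X * (p - 1)"
  shows "s ^ 2 = 1 - 4 * X ^ 2"
    and "2 * w * s ^ 3 = (2 * X ^ 4 + 6 * X ^ 3 - 9 * X ^ 2 - 5 * X + 2) * s ^ 3
      - (16 * X ^ 7 - 48 * X ^ 6 - 76 * X ^ 5 + 64 * X ^ 4 + 36 * X ^ 3 - 21 * X ^ 2 - 5 * X + 2)"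
proof -
  have cancel: "f = g" if "2 * f = 2 * g" for f g :: 'a
    using that two by simp
  define b where "b = p - 1"
  have p_b: "p = 1 + b"
    by (simp add: b_def)
  \<comment> \<open>Adding the equations for \<open>p\<close> and \<open>q\<close> gives
    \<open>p + q = 2\<close>: the even part of the signed series of avoiders is constant.\<close>
  have q_b: "q = 1 - b"
    by (rule cancel) (use p q in \<open>unfold b_def, algebra\<close>)
  \<comment> \<open>The equation of \<open>X\<close> times the Catalan series at
    \<open>X ^ 2\<close>.\<close>
  have b: "b = X + X * b ^ 2"
    by (rule cancel) (use p in \<open>unfold p_b q_b, algebra\<close>)
  have s_b: "s = 1 - 2 * X * b"
    by (simp add: s b_def)
  show "s ^ 2 = 1 - 4 * X ^ 2"
    unfolding s_b using b by algebra
  define A1 B1 A2 B2 where "A1 = u + v" and "B1 = u - v" and "A2 = w + t" and "B2 = w - t"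
  have u': "2 * u = A1 + B1" and v': "2 * v = A1 - B1" and w': "2 * w = A2 + B2" and t': "2 * t = A2 - B2"
    by (simp_all add: A1_def B1_def A2_def B2_def)
  have A1: "A1 = - 2 * X ^ 2 * b ^ 2"
    by (rule cancel) (use u v in \<open>unfold A1_def p_b q_b, algebra\<close>)
  have B1: "B1 * s = 2 * X * A1 - 2 * X ^ 2 * b"
    by (rule cancel) (use u v in \<open>unfold A1_def B1_def s_b p_b q_b, algebra\<close>)
  have A2: "A2 = X ^ 2 * (4 * b ^ 2 - A1 - 2 * b * B1)"
    by (rule cancel) (use w t in \<open>unfold A1_def B1_def A2_def p_b q_b, algebra\<close>)
  have "2 * (2 * B2 * s) = 2 * (X * (4 * A2 + A1 ^ 2 + B1 ^ 2) + 2 * X ^ 2 * (2 * b - B1 - 2 * X - 2 * X * b ^ 2))"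
    using w t unfolding A1_def B1_def A2_def B2_def s_b p_b q_b by algebra
  from cancel[OF this] b have B2: "2 * B2 * s = X * (4 * A2 + A1 ^ 2 + B1 ^ 2) - 2 * X ^ 2 * B1"
    by algebra
  have A2': "A2 * s = X ^ 2 * ((4 * b ^ 2 - A1) * s - 2 * b * (B1 * s))"
    unfolding A2 by algebra
  \<comment> \<open>\<open>A2\<close> and \<open>B1\<close> have denominator \<open>s\<close>, and
    \<open>B2\<close> contains the square of \<open>B1\<close> over a further \<open>s\<close>. So
    \<open>s ^ 3\<close> clears everything down to \<open>b\<close>.\<close>
  have "2 * (2 * w * s ^ 3) = 2 * (A2 * s) * s ^ 2 + X * (4 * (A2 * s) * s + A1 ^ 2 * s ^ 2 + (B1 * s) ^ 2)
      - 2 * X ^ 2 * (B1 * s) * s"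
    using B2 w' by algebra
  also have "\<dots> = 2 * ((2 * X ^ 4 + 6 * X ^ 3 - 9 * X ^ 2 - 5 * X + 2) * s ^ 3
      - (16 * X ^ 7 - 48 * X ^ 6 - 76 * X ^ 5 + 64 * X ^ 4 + 36 * X ^ 3 - 21 * X ^ 2 - 5 * X + 2))"
    unfolding A2' B1 unfolding A1 s_b using b by algebra
  finally show "2 * w * s ^ 3 = (2 * X ^ 4 + 6 * X ^ 3 - 9 * X ^ 2 - 5 * X + 2) * s ^ 3
      - (16 * X ^ 7 - 48 * X ^ 6 - 76 * X ^ 5 + 64 * X ^ 4 + 36 * X ^ 3 - 21 * X ^ 2 - 5 * X + 2)"
    by (rule cancel)
qed

section \<open>Back to even and odd permutations\<close>

context sign_weight
begin

lemma occ_coef_eq_card: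
  "occ_coef e r n = of_nat (card (even_perms_132 r n)) + e * of_nat (card (odd_perms_132 r n))"
proof -
  let ?P = "{p. p permutes {1..n}}" and ?h = "\<lambda>p. map p [1..<Suc n]"
  have fin: "finite ?P"
    by (simp add: finite_permutations)
  have even: "e ^ k = 1" if "even k" for k
    using power_cong_parity[of k 0] that by simp
  have odd: "e ^ k = e" if "odd k" for k
    using power_cong_parity[of k 1] that by simp
  have "occ_coef e r n = weight_sum e {1..n} $ r"
    by (simp add: weight_sum_nth)
  also have "\<dots> = (\<Sum>xs\<in>permutations_of_set {1..n}. weight e xs $ r)"
    by (simp add: weight_sum_def fps_sum_nth)
  also have "\<dots> = (\<Sum>p\<in>?P. weight e (?h p) $ r)"
    by (rule sum.reindex_bij_betw[OF bij_betw_permutes_lists, symmetric])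
  also have "\<dots> = (\<Sum>p\<in>?P. if card (occurrences_132 n p) = r then e ^ card (inversions n p) else 0)"
    by (simp only: card_occurrences_132 card_inversions weight_def fps_mult_left_const_nth fps_X_power_nth)
      (auto intro: sum.cong)
  also have "\<dots> = (\<Sum>p\<in>even_perms_132 r n \<union> odd_perms_132 r n. e ^ card (inversions n p))"
    using fin by (intro sum.mono_neutral_cong_right) (auto simp: even_perms_132_def odd_perms_132_def)
  also have "\<dots> = (\<Sum>p\<in>even_perms_132 r n. e ^ card (inversions n p))
      + (\<Sum>p\<in>odd_perms_132 r n. e ^ card (inversions n p))"
    using fin by (intro sum.union_disjoint) (auto simp: even_perms_132_def odd_perms_132_def)
  also have "(\<Sum>p\<in>even_perms_132 r n. e ^ card (inversions n p)) = of_nat (card (even_perms_132 r n))"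
    by (simp add: even_perms_132_def even)
  also have "(\<Sum>p\<in>odd_perms_132 r n. e ^ card (inversions n p)) = e * of_nat (card (odd_perms_132 r n))"
    by (simp add: odd_perms_132_def odd)
  finally show ?thesis .
qed

lemma occ_series_2_eq: "occ_series 2 = E2 + fps_const e * O2"
  by (rule fps_ext) (simp add: occ_series_nth occ_coef_eq_card E2_def O2_def)

end

section \<open>The signs 1 and -1\<close>

interpretation plus: sign_weight 1
  by unfold_locales simp

interpretation minus: sign_weight "-1"
  by unfold_locales simp

lemma plus_twist: "plus.twist f g = f * g"
  by (rule fps_ext) (simp add: plus.twist_def fps_mult_nth atLeast0AtMost)

lemma plus_flip: "plus.flip f = f"
  by (rule fps_ext) (simp add: plus.flip_def)

lemma flip_add: "minus.flip (f + g) = minus.flip f + minus.flip g"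
  by (rule fps_ext) (simp add: minus.flip_def algebra_simps)

lemma flip_diff: "minus.flip (f - g) = minus.flip f - minus.flip g"
  by (rule fps_ext) (simp add: minus.flip_def algebra_simps)

lemma flip_uminus: "minus.flip (- f) = - minus.flip f"
  by (rule fps_ext) (simp add: minus.flip_def)

lemma flip_one: "minus.flip 1 = 1"
  by (rule fps_ext) (simp add: minus.flip_def)

lemma flip_numeral: "minus.flip (numeral k) = numeral k"
  by (rule fps_ext) (simp add: minus.flip_def fps_numeral_nth)

lemma flip_X: "minus.flip X = - X"
  by (rule fps_ext) (simp add: minus.flip_def)

lemma flip_flip: "minus.flip (minus.flip f) = f"
  by (rule fps_ext) (simp add: minus.flip_def flip: power_mult_distrib mult.assoc)

lemma flip_mult: "minus.flip (f * g) = minus.flip f * minus.flip g"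
proof (rule fps_ext)
  fix n
  have "(- 1) ^ n * (f $ i * g $ (n - i)) = ((- 1) ^ i * f $ i) * ((- 1) ^ (n - i) * g $ (n - i))"
    if "i \<le> n" for i
    using power_add[of "-1 :: rat" i "n - i"] that by simp
  note key = this
  show "minus.flip (f * g) $ n = (minus.flip f * minus.flip g) $ n"
    unfolding minus.flip_def fps_mult_nth fps_nth_Abs_fps sum_distrib_left
    by (intro sum.cong refl key) simp
qed

lemma flip_power: "minus.flip (f ^ n) = minus.flip f ^ n"
  by (induction n) (simp_all add: flip_one flip_mult)

text \<open>\<open>minus.flip\<close> is an involutive ring homomorphism, so applying it to an
  equation between series yields the equation for their images under \<open>x\<close> to
  \<open>-x\<close>.\<close>

lemmas flip_simps = flip_add flip_diff flip_uminus flip_one flip_numeral flip_X flip_flip flip_mult flip_power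

text \<open>The sign is negative exactly for \<open>i\<close> even and \<open>n - i\<close> odd.
  Twice the sign is a combination of \<open>1\<close>, \<open>(-1) ^ i\<close>,
  \<open>(-1) ^ (n - i)\<close> and their product, and each such power flips one factor.\<close>

lemma two_minus_twist:
  "2 * minus.twist f g = f * g + f * minus.flip g - minus.flip f * g + minus.flip f * minus.flip g"
proof (rule fps_ext)
  fix n
  have sign: "2 * ((- 1) ^ ((n - i) * (1 + i))) = (1 + (- 1) ^ (n - i) - (- 1) ^ i + (- 1) ^ i * (- 1) ^ (n - i) :: rat)" for i
    by (cases "even i"; cases "even (n - i)") auto
  have "2 * minus.twist f g $ n = (\<Sum>i\<le>n. 2 * ((- 1) ^ ((n - i) * (1 + i))) * (f $ i * g $ (n - i)))"
    by (simp add: minus.twist_def sum_distrib_left mult.assoc)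
  also have "\<dots> = (\<Sum>i\<le>n. f $ i * g $ (n - i) + f $ i * ((- 1) ^ (n - i) * g $ (n - i))
      - (- 1) ^ i * f $ i * g $ (n - i) + (- 1) ^ i * f $ i * ((- 1) ^ (n - i) * g $ (n - i)))"
    unfolding sign by (simp add: algebra_simps)
  also have "\<dots> = (f * g + f * minus.flip g - minus.flip f * g + minus.flip f * minus.flip g) $ n"
    by (simp add: fps_mult_nth atLeast0AtMost minus.flip_def sum.distrib sum_subtractf)
  finally show "(2 * minus.twist f g) $ n
      = (f * g + f * minus.flip g - minus.flip f * g + minus.flip f * minus.flip g) $ n"
    by (simp add: fps_numeral_fps_const)
qed

text \<open>The square of the product is \<open>g ^ (-3) * g ^ 3 = 1\<close>, and the constant term
  decides between the roots \<open>1\<close> and \<open>-1\<close>.\<close>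

lemma fps_powr_minus_three_halves:
  fixes g s :: "rat fps"
  assumes "s ^ 2 = g" "s $ 0 = 1"
  shows "fps_powr g (- 3 / 2) * s ^ 3 = 1"
proof -
  let ?P = "fps_powr g (- 3 / 2)"
  have g0: "(g - 1) $ 0 = 0"
    using assms by (auto simp: fps_power_zeroth)
  have "fps_binomial (- 3 / 2) ^ 2 * (1 + X) ^ 3 = (1 :: rat fps)"
    unfolding fps_binomial_power using fps_binomial_of_nat[of 3, where ?'a = rat, symmetric]
    by (simp flip: fps_binomial_add_mult)
  \<comment> \<open>Composition with \<open>g - 1\<close> turns \<open>1 + X\<close> into
    \<open>g\<close>; it respects products because \<open>g - 1\<close> has no constant
    term.\<close>
  then have "(fps_binomial (- 3 / 2) ^ 2 * (1 + X) ^ 3) oo (g - 1) = 1"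
    by simp
  then have "?P ^ 2 * g ^ 3 = 1"
    using g0 by (simp add: fps_powr_def fps_compose_mult_distrib fps_compose_add_distrib flip: fps_compose_power)
  then have "(?P * s ^ 3) ^ 2 = 1"
    unfolding assms(1)[symmetric] by (simp add: power_mult_distrib flip: power_mult)
  then have "?P * s ^ 3 = 1 \<or> ?P * s ^ 3 = - 1"
    by (simp add: power2_eq_1_iff)
  moreover have "(?P * s ^ 3) $ 0 = 1"
    using assms(2) by (simp add: fps_powr_def fps_power_zeroth)
  moreover have "(- 1 :: rat fps) $ 0 \<noteq> 1"
    by simp
  ultimately show ?thesis
    by metis
qed

lemma plus_series_2:
  "2 * plus.occ_series 2 = X ^ 2 + 3 * X - 2
     + (2 * X ^ 4 - 4 * X ^ 3 + 29 * X ^ 2 - 15 * X + 2) * fps_powr (1 - 4 * X) (- 3 / 2)"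
proof -
  let ?c = "plus.occ_series 0" and ?u = "plus.occ_series 1" and ?w = "plus.occ_series 2"
  define s where "s = 1 - 2 * X * ?c"
  have c: "?c = 1 + X * ?c ^ 2"
    using plus.occ_series_0_rec unfolding plus_twist by (simp only: power2_eq_square)
  have u: "?u = X * (?c * ?u + ?u * ?c) + X ^ 2 * ((?c - 1) * ?c)"
    using plus.occ_series_1_rec unfolding plus_twist fps_const_1_eq_1 mult_1_left .
  have w: "?w = X * (?c * ?w + ?u * ?u + ?w * ?c) + X ^ 2 * (?u * ?c + (?c - 1) * ?u
      + (?c - 1) * (?c - 1) + (?c - 1 - X * ?c) * ?c + 2 * (X * (?c * (?c - 1))))"
    using plus.occ_series_2_rec
    unfolding plus_twist plus.second_max_series_def plus_flip fps_const_1_eq_1 mult_1_left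
      one_add_one fps_numeral_fps_const[symmetric] .
  note s = unsigned_system_solution[OF c u w s_def]
  have "s $ 0 = 1"
    by (simp add: s_def mult.assoc fps_mult_nth_0)
  \<comment> \<open>Multiplication by the power with exponent -3/2 removes
    \<open>s ^ 3\<close>.\<close>
  from s(2) fps_powr_minus_three_halves[OF s(1) this] show ?thesis
    by algebra
qed

lemma minus_series_2:
  "2 * minus.occ_series 2 = 2 * X ^ 4 + 6 * X ^ 3 - 9 * X ^ 2 - 5 * X + 2
     - (16 * X ^ 7 - 48 * X ^ 6 - 76 * X ^ 5 + 64 * X ^ 4 + 36 * X ^ 3 - 21 * X ^ 2 - 5 * X + 2)
        * fps_powr (1 - 4 * X ^ 2) (- 3 / 2)"
proof -
  define p q u v w t where "p = minus.occ_series 0" and "q = minus.flip p"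
    and "u = minus.occ_series 1" and "v = minus.flip u" and "w = minus.occ_series 2" and "t = minus.flip w"
  define s where "s = 1 - 2 * X * (p - 1)"
  have flips: "minus.flip p = q" "minus.flip q = p" "minus.flip u = v" "minus.flip v = u"
    "minus.flip w = t" "minus.flip t = w"
    by (simp_all add: q_def v_def t_def flip_flip)
  note defs = p_def[symmetric] u_def[symmetric] w_def[symmetric]
  \<comment> \<open>Since \<open>1 + e = 0\<close>, the splits with two ascents sharing their upper
    member cancel.\<close>
  have const: "fps_const (- 1 :: rat) = - 1" "fps_const (1 + - 1 :: rat) = 0"
    by (simp_all flip: fps_const_neg)
  have p: "2 * p = 2 + X * (p * p + p * q - q * p + q * q)"
    using minus.occ_series_0_rec two_minus_twist[of p p] unfolding defs flips by algebra
  \<comment> \<open>The mirrored equation, obtained by \<open>minus.flip\<close>; likewise for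
    \<open>v\<close> and \<open>t\<close> below.\<close>
  have q: "2 * q = 2 - X * (q * q + q * p - p * q + p * p)"
    using arg_cong[OF p, of minus.flip] unfolding flip_simps flips by simp
  have u: "2 * u = X * ((p * u + p * v - q * u + q * v) + (u * p + u * q - v * p + v * q))
      - X ^ 2 * ((p - 1) * p + (p - 1) * q - (q - 1) * p + (q - 1) * q)"
    using minus.occ_series_1_rec two_minus_twist[of p u] two_minus_twist[of u p] two_minus_twist[of "p - 1" p]
    unfolding defs flip_simps flips const by algebra
  have v: "2 * v = - (X * ((q * v + q * u - p * v + p * u) + (v * q + v * p - u * q + u * p)))
      - X ^ 2 * ((q - 1) * q + (q - 1) * p - (p - 1) * q + (p - 1) * p)"
    using arg_cong[OF u, of minus.flip] unfolding flip_simps flips by simp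
  have w: "2 * w = X * ((p * w + p * t - q * w + q * t) + (u * u + u * v - v * u + v * v)
        + (w * p + w * q - t * p + t * q))
      + X ^ 2 * (- ((u * p + u * q - v * p + v * q) + ((p - 1) * u + (p - 1) * v - (q - 1) * u + (q - 1) * v))
        + ((p - 1) * (p - 1) + (p - 1) * (q - 1) - (q - 1) * (p - 1) + (q - 1) * (q - 1))
        + ((p - 1 - X * q) * p + (p - 1 - X * q) * q - (q - 1 + X * p) * p + (q - 1 + X * p) * q))"
    using minus.occ_series_2_rec two_minus_twist[of p w] two_minus_twist[of u u] two_minus_twist[of w p] two_minus_twist[of u p]
      two_minus_twist[of "p - 1" u] two_minus_twist[of "p - 1" "p - 1"] two_minus_twist[of "p - 1 - X * q" p]
    unfolding minus.second_max_series_def defs flip_simps flips const by algebra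
  have t: "2 * t = - (X * ((q * t + q * w - p * t + p * w) + (v * v + v * u - u * v + u * u)
        + (t * q + t * p - w * q + w * p)))
      + X ^ 2 * (- ((v * q + v * p - u * q + u * p) + ((q - 1) * v + (q - 1) * u - (p - 1) * v + (p - 1) * u))
        + ((q - 1) * (q - 1) + (q - 1) * (p - 1) - (p - 1) * (q - 1) + (p - 1) * (p - 1))
        + ((q - 1 + X * p) * q + (q - 1 + X * p) * p - (p - 1 - X * q) * q + (p - 1 - X * q) * p))"
    using arg_cong[OF w, of minus.flip] unfolding flip_simps flips by simp
  have two: "(2 :: rat fps) \<noteq> 0"
    by (simp add: fps_numeral_fps_const)
  note s = signed_system_solution[OF two p q u v w t s_def]
  have "s $ 0 = 1"
    by (simp add: s_def mult.assoc fps_mult_nth_0)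
  from s(2) fps_powr_minus_three_halves[OF s(1) this] show ?thesis
    unfolding w_def[symmetric] by algebra
qed

theorem theorem6:
  shows
    "E2 = fps_const (1 / 2) * X * (X ^ 3 + 3 * X ^ 2 - 4 * X - 1)
        + fps_const (1 / 4) * (2 * X ^ 4 - 4 * X ^ 3 + 29 * X ^ 2 - 15 * X + 2) * fps_powr (1 - 4 * X) (- 3 / 2)
        - fps_const (1 / 4) * (16 * X ^ 7 - 48 * X ^ 6 - 76 * X ^ 5 + 64 * X ^ 4 + 36 * X ^ 3 - 21 * X ^ 2 - 5 * X + 2)
            * fps_powr (1 - 4 * X ^ 2) (- 3 / 2)
     \<and>
     O2 = - fps_const (1 / 2) * (X ^ 4 + 3 * X ^ 3 - 5 * X ^ 2 - 4 * X + 2)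
        + fps_const (1 / 4) * (2 * X ^ 4 - 4 * X ^ 3 + 29 * X ^ 2 - 15 * X + 2) * fps_powr (1 - 4 * X) (- 3 / 2)
        + fps_const (1 / 4) * (16 * X ^ 7 - 48 * X ^ 6 - 76 * X ^ 5 + 64 * X ^ 4 + 36 * X ^ 3 - 21 * X ^ 2 - 5 * X + 2)
            * fps_powr (1 - 4 * X ^ 2) (- 3 / 2)
     \<and>
     F2 = fps_const (1 / 2) * (X ^ 2 + 3 * X - 2)
        + fps_const (1 / 2) * (2 * X ^ 4 - 4 * X ^ 3 + 29 * X ^ 2 - 15 * X + 2) * fps_powr (1 - 4 * X) (- 3 / 2)"
proof -
  \<comment> \<open>The rational constants enter the algebra only as inverses of 2 and 4.\<close>
  have half: "2 * fps_const (1 / 2) = (1 :: rat fps)"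
    and quarter: "4 * fps_const (1 / 4) = (1 :: rat fps)"
    by (simp_all add: fps_numeral_fps_const)
  have sum: "plus.occ_series 2 = E2 + O2"
    using plus.occ_series_2_eq by simp
  have diff: "minus.occ_series 2 = E2 - O2"
    using minus.occ_series_2_eq by (simp flip: fps_const_neg)
  \<comment> \<open>Twice the sum and twice the difference of \<open>E2\<close> and
    \<open>O2\<close> are now known, which determines both series.\<close>
  note total = plus_series_2[unfolded sum] and signed = minus_series_2[unfolded diff]
  show ?thesis
    unfolding F2_def using half quarter total signed by (intro conjI; algebra)
qed

end
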